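(* Let $\rho\ge0$ and let \begin{align*} \mathcal{S}_1&=\left\{(\lambda,\alpha)\in\mathbb{R}^2:\ \lambda>-1,\ -\frac32<\alpha\le\frac12\left(\lambda-\frac32\right)\right\}\\ &\qquad\cup\left\{(\lambda,\alpha)\in\mathbb{R}^2:\ \lambda>-\frac12,\ \frac12\left(\lambda-\frac32\right)<\alpha\le\min\left[\lambda-\frac12,\ \frac12(\lambda-1+\rho)\right]\right\}, \end{align*} and, for integers $n\ge2$, $$\mathcal{S}_n=\left\{(\lambda,\alpha)\in\mathbb{R}^2:\ \lambda>-1,\ -\frac{n+2}{2}<\alpha\le\min\left[\lambda-\frac12,\ \frac12\left(\lambda-\frac{n+1}{2}+\rho\right)\right]\right\}.$$ Let $n\ge1$ be an integer and $(\lambda,\alpha)\in\mathcal{S}_n$. Then the function $$W(\mathbf{x})=\int_0^\infty\left(1-\frac{\|\mathbf{x}\|^2}{t}\right)_+^\lambda t^\alpha\left(1-t\right)_+^\rho\,dt\qquad(\mathbf{x}\in\mathbb{R}^n)$$ has a nonnegative non-vanishing Fourier transform and hence induces positive definite matrices on $\mathbb{R}^n$.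
   Context: $\|\cdot\|$ is the Euclidean norm on $\mathbb{R}^n$. For $s\in\mathbb{R}$ and a real exponent $p$, $(s)_+^p=s^p$ if $s>0$ and $(s)_+^p=0$ if $s\le0$ (in particular $(s)_+^0$ is $1$ for $s>0$ and $0$ otherwise). The Fourier transform is $\widehat W(\xi)=\int_{\mathbb{R}^n}W(\mathbf{x})e^{-i\xi\cdot\mathbf{x}}\,d\mathbf{x}$, $\xi\in\mathbb{R}^n$; "non-vanishing" is meant in the sense of not identically zero. "Induces positive definite matrices on $\mathbb{R}^n$" means that for every finite set of pairwise distinct points $\mathbf{x}_1,\dots,\mathbf{x}_N\in\mathbb{R}^n$ the matrix $\left(W(\mathbf{x}_i-\mathbf{x}_j)\right)_{i,j=1}^N$ is positive definite.
   Formalization: For α ≤ -1 the value W(0) is +∞, so the matrices are not real; there, positive definiteness is read for matrices with finite off-diagonal entries and diagonal +∞ (with 0·∞ = 0); for α > -1 it is the usual notion. *)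

theory Defs
  imports "HOL-Analysis.Analysis"
begin

definition pos_powr :: "real \<Rightarrow> real \<Rightarrow> real" where
  "pos_powr s p = (if 0 < s then s powr p else 0)"

text \<open>Only dimensions \<open>n \<ge> 1\<close> are meant; the second branch is the case \<open>n \<ge> 2\<close>.\<close>

definition buhmann_region :: "nat \<Rightarrow> real \<Rightarrow> (real \<times> real) set" where
  "buhmann_region n \<rho> =
    (if n = 1 then
       {(lam, \<alpha>). lam > -1 \<and> -3/2 < \<alpha> \<and> \<alpha> \<le> 1/2 * (lam - 3/2)} \<union>
       {(lam, \<alpha>). lam > -1/2 \<and> 1/2 * (lam - 3/2) < \<alpha> \<and>
                  \<alpha> \<le> min (lam - 1/2) (1/2 * (lam - 1 + \<rho>))}
     else
       {(lam, \<alpha>). lam > -1 \<and> - (real n + 2) / 2 < \<alpha> \<and>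
                  \<alpha> \<le> min (lam - 1/2) (1/2 * (lam - (real n + 1) / 2 + \<rho>))})"

text \<open>The integrand is nonnegative, so the integral always exists in \<open>[0, \<infinity>]\<close>. The value
  \<open>\<infinity>\<close> does occur: at \<open>x = 0\<close> the integral is that of \<open>t powr \<alpha> * (1 - t) powr \<rho>\<close> over
  \<open>(0, 1)\<close>, which diverges when \<open>\<alpha> \<le> -1\<close>.\<close>

definition buhmann :: "real \<Rightarrow> real \<Rightarrow> real \<Rightarrow> 'a::euclidean_space \<Rightarrow> ennreal" where
  "buhmann lam \<alpha> \<rho> x =
     (\<integral>\<^sup>+ t\<in>{0<..}. ennreal (pos_powr (1 - (norm x)\<^sup>2 / t) lam * t powr \<alpha> * pos_powr (1 - t) \<rho>)
        \<partial>lborel)"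

definition fourier_transform :: "('a::euclidean_space \<Rightarrow> real) \<Rightarrow> 'a \<Rightarrow> complex" where
  "fourier_transform f \<xi> = (LINT x|lborel. of_real (f x) * exp (- \<i> * of_real (\<xi> \<bullet> x)))"

text \<open>Positive definiteness of a symmetric matrix indexed by a finite set \<open>I\<close>, whose off-diagonal
  entries are real and whose diagonal entries may be \<open>+\<infinity>\<close>. As \<open>0 * \<infinity> = 0\<close> in \<^typ>\<open>ereal\<close>
  and infinite entries occur only with coefficients \<open>(c i)\<^sup>2\<close>, the quadratic form is never of
  the shape \<open>\<infinity> - \<infinity>\<close>. For matrices with real entries this is the usual notion.\<close>

definition positive_definite :: "'i set \<Rightarrow> ('i \<Rightarrow> 'i \<Rightarrow> ereal) \<Rightarrow> bool" where
  "positive_definite I A \<longleftrightarrow>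
     (\<forall>i\<in>I. \<forall>j\<in>I. A i j = A j i) \<and>
     (\<forall>i\<in>I. A i i \<noteq> -\<infinity>) \<and>
     (\<forall>i\<in>I. \<forall>j\<in>I. i \<noteq> j \<longrightarrow> \<bar>A i j\<bar> \<noteq> \<infinity>) \<and>
     (\<forall>c :: 'i \<Rightarrow> real. (\<exists>i\<in>I. c i \<noteq> 0) \<longrightarrow>
        0 < (\<Sum>i\<in>I. \<Sum>j\<in>I. ereal (c i * c j) * A i j))"

lemma positive_definite_real:
  "positive_definite I (\<lambda>i j. ereal (A i j)) \<longleftrightarrow>
     (\<forall>i\<in>I. \<forall>j\<in>I. A i j = A j i) \<and>
     (\<forall>c :: 'i \<Rightarrow> real. (\<exists>i\<in>I. c i \<noteq> 0) \<longrightarrow> 0 < (\<Sum>i\<in>I. \<Sum>j\<in>I. c i * c j * A i j))"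
  for A :: "'i \<Rightarrow> 'i \<Rightarrow> real"
  by (simp add: positive_definite_def)

definition induces_positive_definite :: "('a::euclidean_space \<Rightarrow> ereal) \<Rightarrow> bool" where
  "induces_positive_definite W \<longleftrightarrow>
     (\<forall>N. \<forall>x :: nat \<Rightarrow> 'a. inj_on x {..<N} \<longrightarrow>
        positive_definite {..<N} (\<lambda>i j. W (x i - x j)))"

text \<open>So for \<open>\<alpha> > -1\<close> the diagonal entries \<open>W 0\<close> are real and the matrices induced by
  \<open>buhmann\<close> are positive definite in the usual sense.\<close>

lemma buhmann_0_finite:
  assumes "\<alpha> > -1" "\<rho> \<ge> 0"
  shows "buhmann lam \<alpha> \<rho> (0 :: 'a::euclidean_space) < \<infinity>"
proof -
  have "((\<lambda>t. t powr \<alpha>) has_integral (1 powr (\<alpha> + 1) / (\<alpha> + 1))) {0..1}"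
    by (rule has_integral_powr_from_0) (use assms in auto)
  then have "((\<lambda>t. t powr \<alpha>) has_integral 1 / (\<alpha> + 1)) {0..1}"
    by simp
  then have "(\<integral>\<^sup>+ t. ennreal (t powr \<alpha> * indicator {0..1} t) \<partial>lborel) = ennreal (1 / (\<alpha> + 1))"
    by (intro nn_integral_has_integral_lebesgue[where \<Omega> = "{0..1}", simplified mult.commute]) auto
  moreover have "buhmann lam \<alpha> \<rho> (0 :: 'a) \<le> (\<integral>\<^sup>+ t. ennreal (t powr \<alpha> * indicator {0..1} t) \<partial>lborel)"
    unfolding buhmann_def
    by (intro nn_integral_mono)
       (use assms in \<open>auto simp: pos_powr_def indicator_def powr_le1 intro!: ennreal_leI mult_left_le\<close>)
  ultimately show ?thesis
    by (metis ennreal_less_top infinity_ennreal_def order_le_less_trans)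
qed

end

theory Submission
  imports Defs "HOL-Probability.Probability" "HOL-Real_Asymp.Real_Asymp"
begin

text \<open>
  Write \<open>n\<close> for the dimension and put \<open>a = n / 2 + \<alpha> + 1\<close>, \<open>b = n / 2 + \<lambda> + 1\<close> and
  \<open>c = a + \<rho> + 1\<close>. The Buhmann function is a mixture over \<open>t\<close> of the radial functions
  \<open>(1 - \<parallel>x\<parallel>\<^sup>2 / t)\<^sub>+\<^sup>\<lambda>\<close>, whose transforms are Bessel functions, and integrating the
  power series of the Bessel functions term by term gives
  \<open>C * 1F2(a; b, c; - \<parallel>\<xi>\<parallel>\<^sup>2 / 4)\<close> with an explicit \<open>C > 0\<close>
  (\<open>cos_transform_buhmann\<close>). The series is obtained from the moments
  \<open>\<integral> g(\<parallel>x\<parallel>\<^sup>2) (\<xi> \<bullet> x)\<^bsup>2 k\<^esup> dx\<close>. By homogeneity each moment is a constant times a Mellin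
  transform of \<open>g\<close>, and the Gaussian \<open>g\<close> identifies the constant
  (\<open>nn_integral_radial_moment\<close>).

  The nonnegativity of the transform is therefore that of \<open>1F2(a; b, c; - z)\<close> for \<open>z \<ge> 0\<close>.
  Three facts prove it. (1) Raising a lower parameter is a fractional integration with
  nonnegative kernel, hence preserves nonnegativity. (2) For the lower parameters \<open>a + 1/2\<close>
  and \<open>2 * a\<close> the function is the square of a Bessel function. (3) On the segment
  \<open>b + c = 3 * a + 1/2\<close> between \<open>(a + 1/2, 2 * a)\<close> and its mirror image, Gasper expanded it
  into squares of Bessel functions with nonnegative coefficients; the expansion is equivalent,
  coefficient by coefficient, to Dougall's summation of a terminating very well-poised 5F4.
  The inequalities that define the region of parameters ensure that \<open>(b, c)\<close> lies
  componentwise above one of these points (\<open>hyp12_nonneg\<close>, \<open>buhmann_region_parameters\<close>).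

  Positive definiteness follows from the nonnegative transform by Gaussian smoothing
  (\<open>positive_definite_of_cos_transform\<close>): the smoothed quadratic form is the integral of the
  transform against a Gaussian and \<open>\<bar>\<Sum>j. c j * exp(\<i> \<eta> \<bullet> x j)\<bar>\<^sup>2\<close>. It increases
  when the smoothing is removed, and it is positive because a nontrivial exponential sum does
  not vanish on a neighbourhood of \<open>0\<close>, where the transform is positive. This needs the
  function to be bounded and continuous, which holds as soon as its value at \<open>0\<close> is finite;
  if that value is infinite, the diagonal terms alone make every nontrivial quadratic form
  infinite.
\<close>

section \<open>Hypergeometric series and fractional integration\<close>

definition hyp12_coeff :: "real \<Rightarrow> real \<Rightarrow> real \<Rightarrow> nat \<Rightarrow> real" where
  "hyp12_coeff a b c k = pochhammer a k / (pochhammer b k * pochhammer c k * fact k)"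

text \<open>The generalized hypergeometric function 1F2(a; b, c; z).\<close>

definition hyp12 :: "real \<Rightarrow> real \<Rightarrow> real \<Rightarrow> real \<Rightarrow> real" where
  "hyp12 a b c z = (\<Sum>k. hyp12_coeff a b c k * z ^ k)"

text \<open>The function 0F1(; \<open>\<mu>\<close>; z). At \<open>z = - x\<^sup>2 / 4\<close> it is a positive multiple of
  \<open>x powr (1 - \<mu>)\<close> times the Bessel function of order \<open>\<mu> - 1\<close> at \<open>x > 0\<close>.\<close>

definition hyp01 :: "real \<Rightarrow> real \<Rightarrow> real" where
  "hyp01 \<mu> z = (\<Sum>k. z ^ k / (pochhammer \<mu> k * fact k))"

lemma pochhammer_mono:
  fixes x y :: real
  assumes "0 \<le> x" "x \<le> y"
  shows "pochhammer x k \<le> pochhammer y k"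
  unfolding pochhammer_prod by (rule prod_mono) (use assms in auto)

lemma hyp12_coeff_nonneg: "a > 0 \<Longrightarrow> b > 0 \<Longrightarrow> c > 0 \<Longrightarrow> hyp12_coeff a b c k \<ge> 0"
  unfolding hyp12_coeff_def
  by (intro divide_nonneg_nonneg mult_nonneg_nonneg pochhammer_nonneg) auto

lemma hyp12_coeff_Suc:
  "hyp12_coeff a b c (Suc k) =
     hyp12_coeff a b c k * ((a + real k) / ((b + real k) * (c + real k) * real (Suc k)))"
  by (simp add: hyp12_coeff_def pochhammer_Suc mult_ac)

lemma summable_hyp12:
  assumes "a > 0" "b > 0" "c > 0"
  shows "summable (\<lambda>k. norm (hyp12_coeff a b c k * z ^ k))"
proof -
  have lim: "(\<lambda>k. \<bar>z\<bar> * ((a + real k) / ((b + real k) * (c + real k) * real (Suc k)))) \<longlonglongrightarrow> 0"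
    by real_asymp
  have "eventually (\<lambda>k. \<bar>z\<bar> * ((a + real k) / ((b + real k) * (c + real k) * real (Suc k))) < 1/2) sequentially"
    by (rule order_tendstoD(2)[OF lim]) simp
  then obtain N where N: "\<And>k. k \<ge> N \<Longrightarrow>
      \<bar>z\<bar> * ((a + real k) / ((b + real k) * (c + real k) * real (Suc k))) < 1/2"
    unfolding eventually_sequentially by blast
  show ?thesis
  proof (rule summable_ratio_test[where c = "1/2" and N = N])
    fix k assume "k \<ge> N"
    let ?h = "hyp12_coeff a b c k" and ?q = "(a + real k) / ((b + real k) * (c + real k) * real (Suc k))"
    have "norm (norm (hyp12_coeff a b c (Suc k) * z ^ Suc k)) = norm (?h * z ^ k) * \<bar>\<bar>z\<bar> * ?q\<bar>"
      by (simp only: hyp12_coeff_Suc) (simp add: abs_mult mult_ac)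
    also have "\<bar>\<bar>z\<bar> * ?q\<bar> = \<bar>z\<bar> * ?q"
      using assms by simp
    also have "norm (?h * z ^ k) * (\<bar>z\<bar> * ?q) \<le> norm (?h * z ^ k) * (1/2)"
      by (rule mult_left_mono) (use N[OF \<open>k \<ge> N\<close>] in auto)
    finally show "norm (norm (hyp12_coeff a b c (Suc k) * z ^ Suc k)) \<le> 1/2 * norm (norm (?h * z ^ k))"
      by simp
  qed simp
qed

lemma hyp12_sums:
  assumes "a > 0" "b > 0" "c > 0"
  shows "(\<lambda>k. hyp12_coeff a b c k * z ^ k) sums hyp12 a b c z"
  unfolding hyp12_def by (intro summable_sums summable_norm_cancel[OF summable_hyp12] assms)

lemma summable_hyp01:
  fixes \<mu> z :: real
  assumes "\<mu> > 0"
  shows "summable (\<lambda>k. norm (z ^ k / (pochhammer \<mu> k * fact k)))"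
proof -
  have "norm (z ^ k / (pochhammer \<mu> k * fact k)) = norm (hyp12_coeff 1 1 \<mu> k * z ^ k)" for k
    by (simp add: hyp12_coeff_def abs_mult mult_ac flip: pochhammer_fact)
  then show ?thesis using summable_hyp12[of 1 1 \<mu> z] assms by simp
qed

lemma hyp12_commute: "hyp12 a b c = hyp12 a c b"
  by (simp add: hyp12_def hyp12_coeff_def fun_eq_iff mult_ac)

lemma Beta_shift:
  assumes "b > 0" "d > (0 :: real)"
  shows "Beta (b + real k) d = Beta b d * pochhammer b k / pochhammer (b + d) k"
proof -
  have "b \<notin> \<int>\<^sub>\<le>\<^sub>0" "b + d \<notin> \<int>\<^sub>\<le>\<^sub>0"
    using assms by (auto elim!: nonpos_Ints_cases)
  moreover have "Gamma b > 0" "Gamma (b + d) > 0" "Gamma (b + d + real k) > 0" "Gamma (b + real k) > 0"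
    using assms by (auto intro!: Gamma_real_pos)
  ultimately show ?thesis
    by (simp add: Beta_def pochhammer_Gamma field_simps add_ac)
qed

lemma has_bochner_integral_Beta:
  assumes "a > 0" "b > (0 :: real)"
  shows "has_bochner_integral lborel (\<lambda>t. indicator {0<..<1} t * (t powr (a - 1) * (1 - t) powr (b - 1))) (Beta a b)"
proof -
  let ?f = "\<lambda>t. indicator {0..1} t *\<^sub>R (t powr (a - 1) * (1 - t) powr (b - 1))"
  have i: "integrable lborel ?f"
    using integrable_Beta[OF assms] by (simp add: set_integrable_def)
  have "(LINT t:{0..1}|lborel. t powr (a - 1) * (1 - t) powr (b - 1)) = Beta a b"
    using set_borel_integral_eq_integral(2)[OF integrable_Beta[OF assms]]
      integral_unique[OF has_integral_Beta_real[OF assms]] by simp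
  then have "has_bochner_integral lborel ?f (Beta a b)"
    using i by (simp add: has_bochner_integral_iff set_lebesgue_integral_def)
  also have "?f = (\<lambda>t. indicator {0<..<1} t * (t powr (a - 1) * (1 - t) powr (b - 1)))"
    by (auto simp: fun_eq_iff indicator_def)
  finally show ?thesis .
qed

text \<open>For \<open>d = b' - b > 0\<close>, the quotient of the Pochhammer symbols of \<open>b\<close> and \<open>b'\<close> is
  a moment of the Beta density, by \<open>Beta_shift\<close>. Hence \<open>Beta b d * hyp12 a b' c (- z)\<close>
  is the integral over \<open>0 < t < 1\<close> of \<open>hyp12 a b c (- z * t)\<close> against the nonnegative weight
  \<open>t powr (b - 1) * (1 - t) powr (d - 1)\<close>.\<close>

lemma hyp12_raise_lower_parameter:
  assumes pos: "a > 0" "b > 0" "c > 0" and "b \<le> b'"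
    and nn: "\<And>z. z \<ge> 0 \<Longrightarrow> hyp12 a b c (- z) \<ge> 0" and "z \<ge> 0"
  shows "hyp12 a b' c (- z) \<ge> 0"
proof (cases "b = b'")
  case True
  then show ?thesis using nn \<open>z \<ge> 0\<close> by simp
next
  case False
  define d where "d = b' - b"
  have d: "d > 0" "b' = b + d" using False assms by (auto simp: d_def)
  have B: "Beta b d > 0"
    using pos d by (auto simp: Beta_def intro!: divide_pos_pos mult_pos_pos Gamma_real_pos)
  let ?w = "\<lambda>t. indicator {0<..<1} t * (t powr (b - 1) * (1 - t) powr (d - 1)) :: real"
  let ?F = "\<lambda>k t. hyp12_coeff a b c k * (- z) ^ k * (?w t * t ^ k)"
  have mom: "has_bochner_integral lborel (\<lambda>t. ?w t * t ^ k) (Beta (b + real k) d)" for k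
  proof -
    have "(\<lambda>t. ?w t * t ^ k) =
        (\<lambda>t. indicator {0<..<1} t * (t powr (b + real k - 1) * (1 - t) powr (d - 1)))"
      by (auto simp: fun_eq_iff indicator_def powr_realpow[symmetric] powr_add[symmetric] algebra_simps)
    then show ?thesis
      using has_bochner_integral_Beta[of "b + real k" d] pos d by simp
  qed
  have F: "has_bochner_integral lborel (?F k)
      (hyp12_coeff a b c k * (- z) ^ k * Beta (b + real k) d)" for k
    by (intro has_bochner_integral_mult_right mom)
  have coeff: "hyp12_coeff a b c k * Beta (b + real k) d = Beta b d * hyp12_coeff a b' c k" for k
  proof -
    have "pochhammer b k > 0" using pos by (simp add: pochhammer_pos)
    then show ?thesis
      using pos d by (simp add: Beta_shift hyp12_coeff_def field_simps)
  qed
  have nF: "norm (?F k t) = (hyp12_coeff a b c k * z ^ k) * (?w t * t ^ k)" for k t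
    using hyp12_coeff_nonneg[OF pos, of k] \<open>z \<ge> 0\<close>
    by (auto simp: indicator_def abs_mult power_abs)
  have "(\<lambda>k. integral\<^sup>L lborel (?F k)) sums (\<integral>t. (\<Sum>k. ?F k t) \<partial>lborel)"
  proof (rule sums_integral)
    show "integrable lborel (?F k)" for k
      by (rule integrable.intros[OF F])
    show "AE t in lborel. summable (\<lambda>k. norm (?F k t))"
    proof (rule AE_I2)
      fix t :: real
      have "norm (?F k t) = \<bar>?w t\<bar> * norm (hyp12_coeff a b c k * (- z * t) ^ k)" for k
        by (simp add: abs_mult power_abs power_mult_distrib mult_ac)
      then show "summable (\<lambda>k. norm (?F k t))"
        using summable_mult[OF summable_hyp12[OF pos, of "- z * t"], of "\<bar>?w t\<bar>"] by presburger
    qed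
    have "(\<integral>t. norm (?F k t) \<partial>lborel) = hyp12_coeff a b c k * z ^ k * Beta (b + real k) d" for k
      unfolding nF by (rule has_bochner_integral_integral_eq)
        (intro has_bochner_integral_mult_right mom)
    also have "\<dots> k = Beta b d * (hyp12_coeff a b' c k * z ^ k)" for k
      using coeff[of k] by (metis mult.assoc mult.commute)
    finally have "(\<integral>t. norm (?F k t) \<partial>lborel) = Beta b d * (hyp12_coeff a b' c k * z ^ k)" for k .
    then show "summable (\<lambda>k. \<integral>t. norm (?F k t) \<partial>lborel)"
      using summable_mult[OF summable_norm_cancel[OF summable_hyp12[of a b' c z]], of "Beta b d"] pos d
      by simp
  qed
  moreover have "integral\<^sup>L lborel (?F k) = Beta b d * (hyp12_coeff a b' c k * (- z) ^ k)" for k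
  proof -
    have "integral\<^sup>L lborel (?F k) = hyp12_coeff a b c k * (- z) ^ k * Beta (b + real k) d"
      by (rule has_bochner_integral_integral_eq[OF F])
    then show ?thesis using coeff[of k] by (metis mult.assoc mult.commute)
  qed
  ultimately have "(\<lambda>k. Beta b d * (hyp12_coeff a b' c k * (- z) ^ k)) sums
      (\<integral>t. (\<Sum>k. ?F k t) \<partial>lborel)" by (simp only:)
  moreover have "(\<lambda>k. Beta b d * (hyp12_coeff a b' c k * (- z) ^ k)) sums (Beta b d * hyp12 a b' c (- z))"
    by (intro sums_mult hyp12_sums) (use pos d in auto)
  ultimately have eq: "Beta b d * hyp12 a b' c (- z) = (\<integral>t. (\<Sum>k. ?F k t) \<partial>lborel)"
    using sums_unique2 by blast
  have "(\<Sum>k. ?F k t) \<ge> 0" for t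
  proof -
    have "(\<lambda>k. ?w t * (hyp12_coeff a b c k * (- (z * t)) ^ k)) sums (?w t * hyp12 a b c (- (z * t)))"
      by (intro sums_mult hyp12_sums pos)
    also have "(\<lambda>k. ?w t * (hyp12_coeff a b c k * (- (z * t)) ^ k)) = (\<lambda>k. ?F k t)"
    proof
      fix k
      have "(- (z * t)) ^ k = (- z) ^ k * t ^ k" by (metis minus_mult_left power_mult_distrib)
      then show "?w t * (hyp12_coeff a b c k * (- (z * t)) ^ k) = ?F k t" by (simp only: mult_ac)
    qed
    finally have "(\<Sum>k. ?F k t) = ?w t * hyp12 a b c (- (z * t))"
      by (simp add: sums_iff)
    also have "\<dots> \<ge> 0"
      using nn[of "z * t"] \<open>z \<ge> 0\<close> by (cases "t \<in> {0<..<1}") auto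
    finally show ?thesis .
  qed
  then have "Beta b d * hyp12 a b' c (- z) \<ge> 0"
    unfolding eq by (intro Bochner_Integration.integral_nonneg)
  then show ?thesis using B by (simp add: zero_le_mult_iff)
qed

section \<open>Squares of Bessel functions\<close>

text \<open>The Cauchy product of the series with itself: after multiplication by
  \<open>(pochhammer \<mu> k)\<^sup>2\<close>, the sum is the Vandermonde convolution of the generalized binomial
  coefficients of \<open>\<mu> - 1 + k\<close>.\<close>

lemma hyp01_square_coeff:
  fixes \<mu> :: real
  assumes "\<mu> > 0"
  shows "(\<Sum>j\<le>k. 1 / (pochhammer \<mu> j * fact j) * (1 / (pochhammer \<mu> (k - j) * fact (k - j)))) =
     pochhammer (2 * \<mu> - 1 + real k) k / ((pochhammer \<mu> k)\<^sup>2 * fact k)"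
proof -
  have pos: "pochhammer \<mu> j > 0" for j using assms by (simp add: pochhammer_pos)
  define x where "x = \<mu> - 1 + real k"
  have g: "x gchoose j = pochhammer \<mu> k / (pochhammer \<mu> (k - j) * fact j)" if "j \<le> k" for j
  proof -
    have "x gchoose j = pochhammer (\<mu> + real (k - j)) j / fact j"
      using that by (simp add: gbinomial_pochhammer' x_def of_nat_diff algebra_simps)
    moreover have "pochhammer \<mu> k = pochhammer \<mu> (k - j) * pochhammer (\<mu> + real (k - j)) j"
      using pochhammer_product[of "k - j" k \<mu>] that by simp
    ultimately show ?thesis using pos[of "k - j"] by simp
  qed
  have "(\<Sum>j\<le>k. (x gchoose j) * (x gchoose (k - j))) = (x + x) gchoose k"
    using gbinomial_Vandermonde[of x x k] by (simp add: atLeast0AtMost)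
  also have "\<dots> = pochhammer (2 * \<mu> - 1 + real k) k / fact k"
    by (simp add: gbinomial_pochhammer' x_def algebra_simps)
  also have "(\<Sum>j\<le>k. (x gchoose j) * (x gchoose (k - j))) =
     (\<Sum>j\<le>k. (pochhammer \<mu> k)\<^sup>2 *
        (1 / (pochhammer \<mu> j * fact j) * (1 / (pochhammer \<mu> (k - j) * fact (k - j)))))"
    by (intro sum.cong) (auto simp: g power2_eq_square)
  finally show ?thesis
    unfolding sum_distrib_left[symmetric] using pos[of k]
    by (simp add: eq_divide_eq mult_ac)
qed

lemma hyp01_square_sums:
  assumes "\<mu> > 0"
  shows "(\<lambda>k. pochhammer (2 * \<mu> - 1 + real k) k / ((pochhammer \<mu> k)\<^sup>2 * fact k) * z ^ k)
     sums (hyp01 \<mu> z)\<^sup>2"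
proof -
  let ?f = "\<lambda>k. z ^ k / (pochhammer \<mu> k * fact k)"
  have "(\<lambda>k. \<Sum>j\<le>k. ?f j * ?f (k - j)) sums ((\<Sum>k. ?f k) * (\<Sum>k. ?f k))"
    by (intro Cauchy_product_sums summable_hyp01 assms)
  moreover have "(\<Sum>j\<le>k. ?f j * ?f (k - j)) =
      pochhammer (2 * \<mu> - 1 + real k) k / ((pochhammer \<mu> k)\<^sup>2 * fact k) * z ^ k" for k
  proof -
    have "(\<Sum>j\<le>k. ?f j * ?f (k - j)) = (\<Sum>j\<le>k. z ^ k *
        (1 / (pochhammer \<mu> j * fact j) * (1 / (pochhammer \<mu> (k - j) * fact (k - j)))))"
      by (intro sum.cong) (auto simp flip: power_add)
    also have "\<dots> = z ^ k * (pochhammer (2 * \<mu> - 1 + real k) k / ((pochhammer \<mu> k)\<^sup>2 * fact k))"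
      unfolding sum_distrib_left[symmetric] hyp01_square_coeff[OF assms] ..
    finally show ?thesis by simp
  qed
  ultimately show ?thesis by (simp add: hyp01_def power2_eq_square)
qed

text \<open>The duplication formula for the Pochhammer symbol turns the coefficients of the squared
  Bessel series into those of a 1F2. The parameters met here are the vertex
  \<open>(a + 1/2, 2 * a)\<close> of the region of nonnegativity.\<close>

lemma hyp12_square:
  assumes "a > 0"
  shows "hyp12 a (a + 1/2) (2 * a) (4 * z) = (hyp01 (a + 1/2) z)\<^sup>2"
proof -
  have "pochhammer (2 * (a + 1/2) - 1 + real k) k / ((pochhammer (a + 1/2) k)\<^sup>2 * fact k) * z ^ k =
     hyp12_coeff a (a + 1/2) (2 * a) k * (4 * z) ^ k" for k
  proof -
    have pos: "pochhammer (a + 1/2) k > 0" "pochhammer (2 * a) k > 0"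
      using assms by (auto intro!: pochhammer_pos)
    have "pochhammer (2 * a) k * pochhammer (2 * a + real k) k = pochhammer (2 * a) (2 * k)"
      using pochhammer_product'[of "2 * a" k k] by (simp only: mult_2[of k])
    also have "\<dots> = 4 ^ k * pochhammer a k * pochhammer (a + 1/2) k"
      using pochhammer_double[of a k] by (simp only: power_mult of_nat_power of_nat_numeral power2_eq_square) simp
    finally have "pochhammer (2 * a + real k) k =
        4 ^ k * pochhammer a k * pochhammer (a + 1/2) k / pochhammer (2 * a) k"
      using pos by (simp add: eq_divide_eq mult_ac)
    moreover have "2 * (a + 1/2) - 1 + real k = 2 * a + real k" by simp
    ultimately show ?thesis
      using pos by (simp add: hyp12_coeff_def power_mult_distrib power2_eq_square mult_ac del: add_divide_distrib)
  qed
  then have "(\<lambda>k. hyp12_coeff a (a + 1/2) (2 * a) k * (4 * z) ^ k) sums (hyp01 (a + 1/2) z)\<^sup>2"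
    using hyp01_square_sums[of "a + 1/2" z] assms by simp
  moreover have "(\<lambda>k. hyp12_coeff a (a + 1/2) (2 * a) k * (4 * z) ^ k) sums
      hyp12 a (a + 1/2) (2 * a) (4 * z)"
    using assms by (intro hyp12_sums) auto
  ultimately show ?thesis using sums_unique2 by blast
qed

section \<open>Gasper's sum of squares\<close>

text \<open>The coefficients in Gasper's expansion: with \<open>A = 2 * \<nu>\<close> and \<open>p + q = \<nu>\<close>,
  \<open>hyp12 (\<nu> + 1/2) (\<nu> + 1 + p) (\<nu> + 1 + q) (- 4 * y)\<close> is the sum over \<open>n\<close> of
  \<open>gasper_coeff A p q n * y ^ n * (hyp01 (\<nu> + 1 + n) (- y) / pochhammer (\<nu> + 1) n)\<^sup>2\<close>.
  The leading quotient \<open>(A + 2 * n) / (A + n)\<close> is the very well-poised factor.\<close>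

definition gasper_coeff :: "real \<Rightarrow> real \<Rightarrow> real \<Rightarrow> nat \<Rightarrow> real" where
  "gasper_coeff A p q n = (A + 2 * real n) / (A + real n) *
     (pochhammer (A + 1) n * pochhammer p n * pochhammer q n /
      (fact n * pochhammer (1 + A - q) n * pochhammer (1 + A - p) n))"

text \<open>The Wilf-Zeilberger certificate of the summation below, as a rational identity in
  \<open>x = n\<close> and \<open>y = m\<close>: the terms for \<open>m\<close> and \<open>m + 1\<close>, combined as in the recurrence for the
  claimed value, give a difference in \<open>n\<close>. Both sides are divided by the term for
  \<open>m\<close> and \<open>n\<close>.\<close>

lemma dougall_certificate:
  fixes A p q x y :: real
  assumes "A + 2 * x > 0" "y + 1 - x > 0" "A + 1 + y + x > 0"
  shows "(y + 1) * (1 + A - q + y) * (1 + A - p + y) / ((y + 1 - x) * (A + 1 + y + x))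
       - (1 + A - p - q + y) =
     (A + x) * (p + x) * (q + x) / ((A + 2 * x) * (A + 1 + y + x)) +
     x * (A - q + x) * (A - p + x) / ((A + 2 * x) * (y + 1 - x))"
proof -
  have frac: "U / (Q * R) - E = S / (P * R) + T / (P * Q)"
    if "P * (U - E * Q * R) = S * Q + T * R" "P > 0" "Q > 0" "R > 0" for P Q R U E S T :: real
  proof -
    have "P * Q * R * (U / (Q * R) - E) = P * (U - E * Q * R)"
      using that by (simp add: algebra_simps)
    moreover have "P * Q * R * (S / (P * R) + T / (P * Q)) = S * Q + T * R"
      using that by (simp add: algebra_simps)
    ultimately have "P * Q * R * (U / (Q * R) - E) = P * Q * R * (S / (P * R) + T / (P * Q))"
      using that by simp
    then show ?thesis using that by simp
  qed
  show ?thesis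
    by (rule frac[OF _ assms]) algebra
qed

text \<open>Dougall's terminating very well-poised 5F4 sum. Induction on \<open>m\<close>: both sides satisfy
  the same recurrence of order one in \<open>m\<close>, the left side because its recurrence telescopes in
  \<open>n\<close>.\<close>

lemma dougall_5F4_sum:
  fixes A p q :: real
  assumes "A > 0" "1 + A - p > 0" "1 + A - q > 0"
  shows "(\<Sum>n\<le>m. (-1) ^ n * gasper_coeff A p q n / (fact (m - n) * pochhammer (A + 1) (m + n))) =
     pochhammer (1 + A - p - q) m /
       (pochhammer (1 + A - q) m * pochhammer (1 + A - p) m * fact m)"
proof (induction m)
  case 0
  show ?case using assms by (simp add: gasper_coeff_def)
next
  case (Suc m)
  let ?e = "gasper_coeff A p q"
  define u where "u m n = (-1) ^ n * ?e n / (fact (m - n) * pochhammer (A + 1) (m + n))" for m n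
  \<comment> \<open>The telescoping companion of \<open>u\<close>. It vanishes at \<open>n = 0\<close>, and its value at \<open>n = m + 1\<close>
    cancels the one term of row \<open>m + 1\<close> that has no partner in row \<open>m\<close>.\<close>
  define G where "G n = - ((-1) ^ n * real n * (A - q + real n) * (A - p + real n) * ?e n /
      ((A + 2 * real n) * (fact (Suc m - n) * pochhammer (A + 1) (m + n))))" for n
  define K where "K = (real m + 1) * (1 + A - q + real m) * (1 + A - p + real m)"
  define D where "D = 1 + A - p - q + real m"
  have e_Suc: "real (Suc n) * (1 + A - q + real n) * (1 + A - p + real n) * ?e (Suc n) / (A + 2 * real (Suc n)) =
      (A + real n) * (p + real n) * (q + real n) * ?e n / (A + 2 * real n)" for n
  proof -
    have nz: "A + real n \<noteq> 0" "A + 2 * real n \<noteq> 0" "A + 2 * real (Suc n) \<noteq> 0" "A + 1 + real n \<noteq> 0"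
        "1 + A - q + real n \<noteq> 0" "1 + A - p + real n \<noteq> 0" "real (Suc n) \<noteq> 0"
      using assms by linarith+
    define X where "X = pochhammer (A + 1) n * pochhammer p n * pochhammer q n /
      (fact n * pochhammer (1 + A - q) n * pochhammer (1 + A - p) n)"
    have e: "?e n = (A + 2 * real n) / (A + real n) * X"
      by (simp add: gasper_coeff_def X_def)
    have "?e (Suc n) = (A + 2 * real (Suc n)) / (A + real (Suc n)) *
       (X * ((A + 1 + real n) * (p + real n) * (q + real n) /
         (real (Suc n) * (1 + A - q + real n) * (1 + A - p + real n))))"
      unfolding gasper_coeff_def X_def pochhammer_Suc fact_Suc by (simp add: mult_ac)
    also have "A + real (Suc n) = A + 1 + real n" by simp
    finally have "?e (Suc n) / (A + 2 * real (Suc n)) = X * ((p + real n) * (q + real n) /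
         (real (Suc n) * (1 + A - q + real n) * (1 + A - p + real n)))"
      using nz by (simp only: times_divide_eq_left times_divide_eq_right divide_divide_eq_left
          mult.assoc mult.left_commute[of _ X]) (simp add: divide_simps)
    then have "real (Suc n) * (1 + A - q + real n) * (1 + A - p + real n) *
        (?e (Suc n) / (A + 2 * real (Suc n))) = X * ((p + real n) * (q + real n))"
      using nz by (simp del: of_nat_Suc)
    moreover have "(A + real n) * (p + real n) * (q + real n) * (?e n / (A + 2 * real n)) =
        X * ((p + real n) * (q + real n))"
      unfolding e using nz by simp
    ultimately show ?thesis by (simp only: times_divide_eq_right)
  qed
  have wz: "K * u (Suc m) n - D * u m n = G (Suc n) - G n" if "n \<le> m" for n
  proof -
    define v where "v = u m n"
    have f: "fact (Suc m - n) = (real m + 1 - real n) * (fact (m - n) :: real)"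
      using that by (simp add: Suc_diff_le of_nat_diff)
    have ph: "pochhammer (A + 1) (Suc (m + n)) = pochhammer (A + 1) (m + n) * (A + 1 + real m + real n)"
      by (simp add: pochhammer_Suc add_ac)
    have u1: "u (Suc m) n = v / ((real m + 1 - real n) * (A + 1 + real m + real n))"
      using ph by (simp add: u_def v_def f mult_ac)
    have g0: "G n = - (real n * (A - q + real n) * (A - p + real n) /
        ((A + 2 * real n) * (real m + 1 - real n)) * v)"
      by (simp add: G_def v_def u_def f mult_ac)
    have "G (Suc n) = (-1) ^ n * (real (Suc n) * (1 + A - q + real n) * (1 + A - p + real n) *
        ?e (Suc n) / (A + 2 * real (Suc n))) / (fact (m - n) * pochhammer (A + 1) (Suc (m + n)))"
    proof -
      have "A - q + real (Suc n) = 1 + A - q + real n" "A - p + real (Suc n) = 1 + A - p + real n"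
        by auto
      then show ?thesis unfolding G_def by (simp only: diff_Suc_Suc add_Suc_right) (simp add: mult_ac del: of_nat_Suc)
    qed
    also have "\<dots> = (A + real n) * (p + real n) * (q + real n) /
        ((A + 2 * real n) * (A + 1 + real m + real n)) * v"
      unfolding e_Suc ph by (simp add: v_def u_def mult_ac)
    finally have g1: "G (Suc n) = \<dots>" .
    have "K * u (Suc m) n - D * u m n =
        (K / ((real m + 1 - real n) * (A + 1 + real m + real n)) - D) * v"
      unfolding u1 v_def[symmetric] by (simp add: algebra_simps)
    also have "\<dots> = G (Suc n) - G n"
      unfolding K_def D_def g0 g1
      by (subst dougall_certificate) (use assms that in \<open>auto simp: algebra_simps\<close>)
    finally show ?thesis .
  qed
  have last: "K * u (Suc m) (Suc m) = - G (Suc m)"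
  proof -
    have "pochhammer (A + 1) (Suc m + Suc m) =
        pochhammer (A + 1) (m + Suc m) * (A + 2 * real (Suc m))"
      by (simp add: pochhammer_Suc algebra_simps)
    moreover have "A - q + real (Suc m) = 1 + A - q + real m" "A - p + real (Suc m) = 1 + A - p + real m"
        "real m + 1 = real (Suc m)"
      by auto
    ultimately show ?thesis
      unfolding K_def G_def u_def by (simp only:) (simp add: mult_ac del: of_nat_Suc)
  qed
  have "K * (\<Sum>n\<le>Suc m. u (Suc m) n) - D * (\<Sum>n\<le>m. u m n) =
      (\<Sum>n\<le>m. K * u (Suc m) n - D * u m n) + K * u (Suc m) (Suc m)"
    by (simp add: sum_subtractf sum_distrib_left algebra_simps)
  also have "(\<Sum>n\<le>m. K * u (Suc m) n - D * u m n) = (\<Sum>n\<le>m. G (Suc n) - G n)"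
    by (intro sum.cong) (auto simp: wz)
  also have "\<dots> = G (Suc m) - G 0"
    using sum_telescope''[of 0 m G] by (induction m) (auto)
  also have "\<dots> + K * u (Suc m) (Suc m) = 0"
    unfolding last by (simp add: G_def)
  finally have "K * (\<Sum>n\<le>Suc m. u (Suc m) n) = D * (\<Sum>n\<le>m. u m n)" by simp
  also have "(\<Sum>n\<le>m. u m n) = pochhammer (1 + A - p - q) m /
       (pochhammer (1 + A - q) m * pochhammer (1 + A - p) m * fact m)"
    using Suc.IH by (simp only: u_def)
  finally have *: "K * (\<Sum>n\<le>Suc m. u (Suc m) n) = D * (pochhammer (1 + A - p - q) m /
       (pochhammer (1 + A - q) m * pochhammer (1 + A - p) m * fact m))" .
  have "K \<noteq> 0" using assms unfolding K_def by simp
  then have "(\<Sum>n\<le>Suc m. u (Suc m) n) = D * (pochhammer (1 + A - p - q) m /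
       (pochhammer (1 + A - q) m * pochhammer (1 + A - p) m * fact m)) / K"
    by (simp only: *[symmetric] nonzero_mult_div_cancel_left not_False_eq_True)
  also have "\<dots> = pochhammer (1 + A - p - q) (Suc m) /
       (pochhammer (1 + A - q) (Suc m) * pochhammer (1 + A - p) (Suc m) * fact (Suc m))"
    unfolding K_def D_def pochhammer_Suc fact_Suc by (simp add: mult_ac add_ac)
  finally show ?case by (simp only: u_def)
qed

text \<open>The upper bound holds because each of \<open>p\<close> and \<open>q\<close> is at most the parameter below it.
  It makes the double series of Gasper's expansion converge absolutely.\<close>

lemma gasper_coeff_bounds:
  assumes "A > 0" "0 \<le> p" "0 \<le> q" "p + q \<le> A"
  shows "gasper_coeff A p q n \<ge> 0"
    and "gasper_coeff A p q n \<le> 2 * pochhammer (A + 1) n / fact n"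
proof -
  define r where "r = pochhammer p n * pochhammer q n / (pochhammer (1 + A - q) n * pochhammer (1 + A - p) n)"
  have pos: "pochhammer (1 + A - q) n > 0" "pochhammer (1 + A - p) n > 0" "pochhammer (A + 1) n > 0"
    using assms by (auto intro!: pochhammer_pos)
  have nn: "pochhammer p n \<ge> 0" "pochhammer q n \<ge> 0"
    using assms by (auto simp: pochhammer_prod intro!: prod_nonneg)
  have "pochhammer p n * pochhammer q n \<le> pochhammer (1 + A - q) n * pochhammer (1 + A - p) n"
    using assms pos nn by (intro mult_mono pochhammer_mono) auto
  then have r: "0 \<le> r" "r \<le> 1" using pos nn unfolding r_def by auto
  have s: "0 \<le> (A + 2 * real n) / (A + real n)" "(A + 2 * real n) / (A + real n) \<le> 2"
    using assms by (auto simp: divide_simps)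
  have e: "gasper_coeff A p q n = ((A + 2 * real n) / (A + real n) * r) * (pochhammer (A + 1) n / fact n)"
    by (simp add: gasper_coeff_def r_def mult_ac)
  show "gasper_coeff A p q n \<ge> 0"
    unfolding e using pos s r by (intro mult_nonneg_nonneg) auto
  have "(A + 2 * real n) / (A + real n) * r \<le> 2 * 1"
    using r s by (intro mult_mono) auto
  then have "gasper_coeff A p q n \<le> 2 * (pochhammer (A + 1) n / fact n)"
    unfolding e using pos by (intro mult_right_mono) auto
  then show "gasper_coeff A p q n \<le> 2 * pochhammer (A + 1) n / fact n" by simp
qed

text \<open>The parameters run over the segment from \<open>(a + 1/2, 2 * a)\<close> to its mirror image, where
  \<open>a = \<nu> + 1/2\<close>. Gasper's expansion is a rearrangement of a double series \<open>T m n\<close>: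
  by Dougall's sum the row \<open>m\<close> adds up to the term of order \<open>m\<close> of the 1F2, and the column
  \<open>n\<close> adds up to a nonnegative multiple of the square of a Bessel function.\<close>

lemma hyp12_nonneg_edge:
  assumes "p \<ge> 0" "q \<ge> 0" "p + q > 0" "z \<ge> 0"
  defines "\<nu> \<equiv> p + q"
  shows "hyp12 (\<nu> + 1/2) (\<nu> + 1 + p) (\<nu> + 1 + q) (- z) \<ge> 0"
proof -
  define A where "A = 2 * \<nu>"
  have \<nu>: "\<nu> > 0" "A > 0" "1 + A - q = \<nu> + 1 + p" "1 + A - p = \<nu> + 1 + q" "1 + A - p - q = \<nu> + 1"
      "p + q \<le> A"
    using assms by (auto simp: A_def)
  define y where "y = z / 4"
  have y: "y \<ge> 0" "z = 4 * y" using assms by (auto simp: y_def)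
  let ?e = "gasper_coeff A p q"
  note e = gasper_coeff_bounds[OF \<nu>(2) assms(1,2) \<nu>(6)]
  define R where "R m = pochhammer (\<nu> + 1/2) m / pochhammer (\<nu> + 1) m" for m
  have R: "0 \<le> R m" "R m \<le> 1" for m
    using \<nu> pochhammer_pos[of "\<nu> + 1" m] pochhammer_nonneg[of "\<nu> + 1/2" m]
      pochhammer_mono[of "\<nu> + 1/2" "\<nu> + 1" m] by (auto simp: R_def)
  define T where "T m n = (if n \<le> m then
      (- (4 * y)) ^ m * R m * ((-1) ^ n * ?e n / (fact (m - n) * pochhammer (A + 1) (m + n))) else 0)"
    for m n
  have sum_T: "(\<Sum>n\<le>m. T m n) =
      hyp12_coeff (\<nu> + 1/2) (\<nu> + 1 + p) (\<nu> + 1 + q) m * (- z) ^ m" for m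
  proof -
    have "pochhammer (\<nu> + 1) m > 0" using \<nu> by (intro pochhammer_pos) auto
    moreover have "(\<Sum>n\<le>m. T m n) = (- (4 * y)) ^ m * R m *
        (\<Sum>n\<le>m. (-1) ^ n * ?e n / (fact (m - n) * pochhammer (A + 1) (m + n)))"
      by (simp add: T_def sum_distrib_left)
    moreover have "\<dots> = (- (4 * y)) ^ m * R m *
        (pochhammer (\<nu> + 1) m / (pochhammer (\<nu> + 1 + p) m * pochhammer (\<nu> + 1 + q) m * fact m))"
      using dougall_5F4_sum[of A p q m] \<nu> assms(1,2) by simp
    ultimately show ?thesis by (simp add: R_def hyp12_coeff_def y(2) mult_ac)
  qed
  \<comment> \<open>From \<open>pochhammer (A + 1) (m + n) \<ge> pochhammer (A + 1) n * fact m\<close>; summed over \<open>n\<close> this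
    leaves an exponential series in \<open>8 * y\<close>.\<close>
  have bound_T: "\<bar>T m n\<bar> \<le> 2 * (4 * y) ^ m / fact m * (1 / (fact n * fact (m - n)))" if "n \<le> m" for m n
  proof -
    have pp: "pochhammer (A + 1) n > 0" using \<nu> by (intro pochhammer_pos) auto
    have "fact m = pochhammer (1 :: real) m" by (simp add: pochhammer_fact)
    also have "\<dots> \<le> pochhammer (A + 1 + real n) m"
      using \<nu> by (intro pochhammer_mono) auto
    finally have fm: "fact m \<le> pochhammer (A + 1 + real n) m" .
    have "pochhammer (A + 1) (m + n) = pochhammer (A + 1) n * pochhammer (A + 1 + real n) m"
      using pochhammer_product'[of "A + 1" n m] by (simp add: add_ac)
    then have ge: "pochhammer (A + 1) (m + n) \<ge> pochhammer (A + 1) n * fact m"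
      using fm pp by (simp add: mult_left_mono)
    have "?e n / (fact (m - n) * pochhammer (A + 1) (m + n)) \<le>
        (2 * pochhammer (A + 1) n / fact n) / (fact (m - n) * (pochhammer (A + 1) n * fact m))"
      using e[of n] ge pp by (intro frac_le mult_left_mono) auto
    also have "\<dots> = 2 / (fact n * fact (m - n) * fact m)"
      using pp by (simp add: field_simps)
    finally have E: "?e n / (fact (m - n) * pochhammer (A + 1) (m + n)) \<le>
        2 / (fact n * fact (m - n) * fact m)" .
    have E0: "?e n / (fact (m - n) * pochhammer (A + 1) (m + n)) \<ge> 0"
      using e(1)[of n] pochhammer_nonneg[of "A + 1" "m + n"] \<nu> by simp
    have "\<bar>T m n\<bar> = (4 * y) ^ m * R m * (?e n / (fact (m - n) * pochhammer (A + 1) (m + n)))"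
      using that y R(1)[of m] e(1)[of n] pochhammer_nonneg[of "A + 1" "m + n"] \<nu>(2)
      by (simp add: T_def abs_mult power_abs)
    also have "\<dots> \<le> (4 * y) ^ m * 1 * (2 / (fact n * fact (m - n) * fact m))"
      using y R[of m] E E0 by (intro mult_mono) auto
    finally show ?thesis by (simp add: mult_ac)
  qed
  have sum_abs_T: "(\<Sum>n\<le>m. \<bar>T m n\<bar>) \<le> 2 * ((8 * y) ^ m / fact m)" for m
  proof -
    have "(\<Sum>n\<le>m. \<bar>T m n\<bar>) \<le> (\<Sum>n\<le>m. 2 * (4 * y) ^ m / fact m * (1 / (fact n * fact (m - n))))"
      by (intro sum_mono bound_T) auto
    also have "\<dots> = 2 * (4 * y) ^ m / fact m * ((\<Sum>n\<le>m. real (m choose n)) / fact m)"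
      by (simp add: sum_distrib_left sum_divide_distrib binomial_fact)
    also have "(\<Sum>n\<le>m. real (m choose n)) = 2 ^ m"
      using choose_row_sum[of m] by (metis of_nat_numeral of_nat_power of_nat_sum)
    also have "2 * (4 * y) ^ m / fact m * (2 ^ m / fact m) = 2 * ((8 * y) ^ m / fact m) / fact m"
    proof -
      have "(8 * y) ^ m = (4 * y * 2) ^ m" by simp
      also have "\<dots> = (4 * y) ^ m * 2 ^ m" by (rule power_mult_distrib)
      finally have "(8 * y) ^ m = (4 * y) ^ m * 2 ^ m" .
      then show ?thesis by (simp only:) simp
    qed
    also have "\<dots> \<le> 2 * ((8 * y) ^ m / fact m) / 1"
      using y by (intro divide_left_mono) auto
    finally show ?thesis by simp
  qed
  have column: "(\<lambda>m. T m n) sums (?e n * y ^ n / (pochhammer (\<nu> + 1) n)\<^sup>2 * (hyp01 (\<nu> + 1 + real n) (- y))\<^sup>2)" for n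
  proof -
    let ?s = "\<lambda>k. ?e n * y ^ n / (pochhammer (\<nu> + 1) n)\<^sup>2 *
       (pochhammer (2 * (\<nu> + 1 + real n) - 1 + real k) k / ((pochhammer (\<nu> + 1 + real n) k)\<^sup>2 * fact k) * (- y) ^ k)"
    have "?s sums (?e n * y ^ n / (pochhammer (\<nu> + 1) n)\<^sup>2 * (hyp01 (\<nu> + 1 + real n) (- y))\<^sup>2)"
      by (intro sums_mult hyp01_square_sums) (use \<nu> in auto)
    also have "?s = (\<lambda>k. T (k + n) n)"
    proof
      fix k
      have pos: "pochhammer (\<nu> + 1) (k + n) > 0" "pochhammer (A + 1) (k + n + n) > 0"
        using \<nu> by (auto intro!: pochhammer_pos)
      have P: "pochhammer (\<nu> + 1) (k + n) = pochhammer (\<nu> + 1) n * pochhammer (\<nu> + 1 + real n) k"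
        using pochhammer_product'[of "\<nu> + 1" n k] by (simp add: add_ac)
      \<comment> \<open>The symbols of length \<open>2 * n + k\<close> and \<open>k\<close> join to one of even length, which the
        duplication formula splits.\<close>
      have "pochhammer (A + 1) (k + n + n) * pochhammer (2 * (\<nu> + 1 + real n) - 1 + real k) k =
          pochhammer (A + 1) ((k + n) + (k + n))"
        using pochhammer_product'[of "A + 1" "k + n + n" k] by (simp add: A_def algebra_simps)
      also have "\<dots> = 4 ^ (k + n) * pochhammer (\<nu> + 1/2) (k + n) * pochhammer (\<nu> + 1) (k + n)"
      proof -
        have "(2 :: real) ^ (2 * (k + n)) = 4 ^ (k + n)" by (simp only: power_mult) simp
        moreover have "A + 1 = 2 * (\<nu> + 1/2)" "\<nu> + 1/2 + 1/2 = \<nu> + 1" by (auto simp: A_def)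
        ultimately show ?thesis
          using pochhammer_double[of "\<nu> + 1/2" "k + n"]
          by (simp only: mult_2[of "k + n"] of_nat_power of_nat_numeral)
      qed
      finally have dup: "pochhammer (2 * (\<nu> + 1 + real n) - 1 + real k) k =
          4 ^ (k + n) * pochhammer (\<nu> + 1/2) (k + n) * pochhammer (\<nu> + 1) (k + n) /
          pochhammer (A + 1) (k + n + n)"
        using pos by (simp add: eq_divide_eq mult_ac)
      have sgn: "(- (4 * y)) ^ (k + n) * (-1) ^ n = 4 ^ (k + n) * y ^ n * (- y) ^ k"
      proof -
        have "(- (4 * y)) ^ (k + n) = (4 * (- y)) ^ (k + n)" by simp
        also have "\<dots> = 4 ^ (k + n) * ((- y) ^ k * (- y) ^ n)"
          by (simp only: power_mult_distrib power_add mult_ac)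
        also have "(- y) ^ n = (-1) ^ n * y ^ n" by (rule power_minus)
        finally show ?thesis by simp
      qed
      have arith: "a * b * c * (H / (X * Y)) * E / (F * Q) =
          E * b / X\<^sup>2 * (a * H * (X * Y) / Q / (Y\<^sup>2 * F) * c)"
        if "X * Y > 0" "Q > 0" for a b c E F H Q X Y :: real
        using that by (auto simp: power2_eq_square mult_ac)
      have "T (k + n) n = ((- (4 * y)) ^ (k + n) * (-1) ^ n) * R (k + n) * ?e n /
          (fact k * pochhammer (A + 1) (k + n + n))"
        by (simp add: T_def)
      also have "\<dots> = ?s k"
        unfolding sgn dup R_def
        using pos unfolding P by (intro arith) auto
      finally show "?s k = T (k + n) n" ..
    qed
    finally show ?thesis
      by (subst (asm) sums_zero_iff_shift) (auto simp: T_def)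
  qed
  have nonneg: "(\<Sum>m. \<Sum>n\<le>M. T m n) \<ge> 0" for M
  proof -
    have "(\<lambda>m. \<Sum>n\<le>M. T m n) sums
        (\<Sum>n\<le>M. ?e n * y ^ n / (pochhammer (\<nu> + 1) n)\<^sup>2 * (hyp01 (\<nu> + 1 + real n) (- y))\<^sup>2)"
      by (intro sums_sum column)
    moreover have "(\<Sum>n\<le>M. ?e n * y ^ n / (pochhammer (\<nu> + 1) n)\<^sup>2 * (hyp01 (\<nu> + 1 + real n) (- y))\<^sup>2) \<ge> 0"
      using e y by (intro sum_nonneg mult_nonneg_nonneg divide_nonneg_nonneg) auto
    ultimately show ?thesis by (simp add: sums_iff)
  qed
  \<comment> \<open>Truncating at column \<open>M\<close> keeps the sum nonnegative; Tannery's theorem removes the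
    truncation.\<close>
  have "((\<lambda>M. \<Sum>m. \<Sum>n\<le>M. T m n) \<longlongrightarrow> (\<Sum>m. \<Sum>n\<le>m. T m n)) sequentially"
  proof (rule tannerys_theorem[THEN conjunct2, THEN conjunct2])
    have trunc: "(\<Sum>n\<le>M. T m n) = (\<Sum>n\<le>m. T m n)" if "m \<le> M" for m M
      using that by (intro sum.mono_neutral_right) (auto simp: T_def)
    show "(\<lambda>M. \<Sum>n\<le>M. T m n) \<longlonglongrightarrow> (\<Sum>n\<le>m. T m n)" for m
      by (rule tendsto_eventually, rule eventually_sequentiallyI[where c = m]) (rule trunc)
    show "\<forall>\<^sub>F (m, M) in at_top \<times>\<^sub>F sequentially. norm (\<Sum>n\<le>M. T m n) \<le> 2 * ((8 * y) ^ m / fact m)"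
    proof (rule always_eventually, safe)
      fix m M
      have "norm (\<Sum>n\<le>M. T m n) \<le> (\<Sum>n\<le>M. \<bar>T m n\<bar>)" by (simp add: sum_abs)
      also have "\<dots> \<le> (\<Sum>n\<le>m. \<bar>T m n\<bar>)"
      proof -
        have "(\<Sum>n\<le>M. \<bar>T m n\<bar>) = (\<Sum>n\<in>{..M} \<inter> {..m}. \<bar>T m n\<bar>)"
          by (intro sum.mono_neutral_right) (auto simp: T_def)
        also have "\<dots> \<le> (\<Sum>n\<le>m. \<bar>T m n\<bar>)" by (intro sum_mono2) auto
        finally show ?thesis .
      qed
      also note sum_abs_T
      finally show "norm (\<Sum>n\<le>M. T m n) \<le> 2 * ((8 * y) ^ m / fact m)" .
    qed
    show "summable (\<lambda>m. 2 * ((8 * y) ^ m / fact m))"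
      using summable_mult[OF summable_exp[of "8 * y"], of 2] by (simp add: field_simps)
  qed auto
  then have "(\<Sum>m. \<Sum>n\<le>m. T m n) \<ge> 0"
    by (rule LIMSEQ_le_const) (use nonneg in auto)
  then show ?thesis unfolding sum_T by (simp add: hyp12_def)
qed

text \<open>Starting from a point where the function is a square or a sum of squares, one reaches
  \<open>(b, c)\<close> by raising lower parameters. If \<open>b \<ge> 2 * a\<close>, the vertex \<open>(2 * a, a + 1/2)\<close>
  lies below \<open>(b, c)\<close>. Otherwise \<open>(b, 3 * a + 1/2 - b)\<close> is a point of the edge below
  \<open>(b, c)\<close>, and \<open>p = b - a - 1/2\<close>, \<open>q = 2 * a - b\<close> are its coordinates on the edge.\<close>

theorem hyp12_nonneg:
  assumes "a > 0" "c \<ge> a + 1/2" "b \<ge> 2 * a \<or> (b \<ge> a + 1/2 \<and> b + c \<ge> 3 * a + 1/2)" "z \<ge> 0"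
  shows "hyp12 a b c (- z) \<ge> 0"
proof (cases "b \<ge> 2 * a")
  case True
  have 1: "hyp12 a (a + 1/2) (2 * a) (- z) \<ge> 0" if "z \<ge> 0" for z
    using hyp12_square[OF assms(1), of "- (z / 4)"] by simp
  have 2: "hyp12 a c (2 * a) (- z) \<ge> 0" if "z \<ge> 0" for z
    by (rule hyp12_raise_lower_parameter[OF _ _ _ _ 1]) (use assms that in auto)
  then have 3: "hyp12 a (2 * a) c (- z) \<ge> 0" if "z \<ge> 0" for z
    using that by (simp add: hyp12_commute[of a c "2 * a"])
  show ?thesis
    by (rule hyp12_raise_lower_parameter[OF _ _ _ _ 3]) (use assms True in auto)
next
  case False
  define p q where "p = b - a - 1/2" and "q = 2 * a - b"
  have pq: "p \<ge> 0" "q \<ge> 0" "p + q > 0" "p + q + 1/2 = a" "p + q + 1 + p = b" "p + q + 1 + q = 3 * a + 1/2 - b"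
    using assms False by (auto simp: p_def q_def)
  have "hyp12 a b (3 * a + 1/2 - b) (- z) \<ge> 0" if "z \<ge> 0" for z
    using hyp12_nonneg_edge[OF pq(1-3) that] unfolding pq(4-6) .
  then have 1: "hyp12 a (3 * a + 1/2 - b) b (- z) \<ge> 0" if "z \<ge> 0" for z
    using that by (simp add: hyp12_commute[of a b])
  have "hyp12 a c b (- z) \<ge> 0"
    by (rule hyp12_raise_lower_parameter[OF _ _ _ _ 1]) (use assms False in auto)
  then show ?thesis by (simp add: hyp12_commute[of a b])
qed

section \<open>Moments and cosine transforms of radial functions\<close>

lemma powser_eq_0_imp_coeff_eq_0:
  fixes a :: "nat \<Rightarrow> real"
  assumes "\<And>x. x > 0 \<Longrightarrow> (\<lambda>n. a n * x ^ n) sums 0"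
  shows "a n = 0"
  using assms
proof (induction n arbitrary: a)
  have zero: "a 0 = 0" if sums: "\<And>x. x > 0 \<Longrightarrow> (\<lambda>n. a n * x ^ n) sums 0" for a :: "nat \<Rightarrow> real"
  proof -
    have "(\<lambda>n. a n * x ^ n) sums (\<Sum>n. a n * x ^ n)" for x
    proof -
      have "summable (\<lambda>n. a n * (\<bar>x\<bar> + 1) ^ n)"
        by (rule sums_summable[OF sums]) auto
      then show ?thesis by (rule summable_sums[OF powser_inside]) simp
    qed
    then have "((\<lambda>x. \<Sum>n. a n * x ^ n) \<longlongrightarrow> a 0) (at 0)"
      by (intro powser_limit_0[of 1]) auto
    then have 1: "((\<lambda>x. \<Sum>n. a n * x ^ n) \<longlongrightarrow> a 0) (at_right 0)"
      by (rule filterlim_at_split[THEN iffD1, THEN conjunct2])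
    have "\<forall>\<^sub>F x in at_right 0. (\<Sum>n. a n * x ^ n) = 0"
      using eventually_at_right_less[of 0] by eventually_elim (use sums in \<open>auto simp: sums_iff\<close>)
    then have "((\<lambda>x. \<Sum>n. a n * x ^ n) \<longlongrightarrow> 0) (at_right 0)"
      by (rule tendsto_eventually)
    with 1 show ?thesis using tendsto_unique trivial_limit_at_right_real by blast
  qed
  case (0 a)
  then show ?case by (rule zero)
  case (Suc n a)
  have "(\<lambda>k. a (Suc k) * x ^ k) sums 0" if x: "x > 0" for x
  proof -
    have "(\<lambda>k. a (Suc k) * x ^ Suc k) sums 0"
      using Suc.prems[OF x] zero[OF Suc.prems] by (subst sums_Suc_iff) simp
    from sums_mult[OF this, of "1 / x"] show ?thesis using x by (simp add: field_simps)
  qed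
  then show ?case by (rule Suc.IH)
qed

lemma nn_integral_scaleR:
  fixes f :: "'a::euclidean_space \<Rightarrow> ennreal"
  assumes [measurable]: "f \<in> borel_measurable borel" and c: "c > 0"
  shows "(\<integral>\<^sup>+x. f x \<partial>lborel) = ennreal (c ^ DIM('a)) * (\<integral>\<^sup>+x. f (c *\<^sub>R x) \<partial>lborel)"
proof -
  have "c \<noteq> 0" using c by simp
  show ?thesis
    by (subst lborel_affine[OF \<open>c \<noteq> 0\<close>, of 0])
       (use c in \<open>simp add: nn_integral_density nn_integral_distr nn_integral_cmult\<close>)
qed

lemma nn_integral_powr_Ioc:
  assumes "D > 0" "s \<ge> 0"
  shows "(\<integral>\<^sup>+t. ennreal (indicator {0<..s} t * t powr (D - 1)) \<partial>lborel) = ennreal (s powr D / D)"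
proof -
  have "((\<lambda>t. t powr (D - 1)) has_integral (s powr (D - 1 + 1) / (D - 1 + 1))) {0..s}"
    by (rule has_integral_powr_from_0) (use assms in auto)
  then have "(\<integral>\<^sup>+t. ennreal (indicator {0..s} t * t powr (D - 1)) \<partial>lborel) = ennreal (s powr D / D)"
    by (intro nn_integral_has_integral_lebesgue) auto
  also have "(\<lambda>t. indicator {0..s} t * t powr (D - 1)) = (\<lambda>t. indicator {0<..s} t * t powr (D - 1))"
    by (auto simp: fun_eq_iff indicator_def)
  finally show ?thesis .
qed

lemma nn_integral_Gamma:
  assumes "D > (0 :: real)"
  shows "(\<integral>\<^sup>+s. ennreal (indicator {0<..} s * (exp (- s) * s powr (D - 1))) \<partial>lborel) = ennreal (Gamma D)"
proof -
  have "indicator {0<..} s * (exp (- s) * s powr (D - 1)) = indicator {0..} s * s powr (D - 1) / exp s"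
    for s :: real
    by (auto simp: indicator_def exp_minus field_simps)
  then show ?thesis unfolding Gamma_conv_nn_integral_real[OF assms] by simp
qed

text \<open>Integration in polar coordinates without spheres. The image of the measure
  \<open>h x dx\<close> under \<open>x \<mapsto> \<parallel>x\<parallel>\<^sup>2\<close> gives the interval up to \<open>s\<close> the mass \<open>V * s powr D\<close>, by
  scaling, so it has the density \<open>D * V * s powr (D - 1)\<close> on the positive half-line.\<close>

lemma nn_integral_radial_homogeneous:
  fixes h :: "'a::euclidean_space \<Rightarrow> real" and g :: "real \<Rightarrow> ennreal"
  assumes [measurable]: "h \<in> borel_measurable borel" "g \<in> borel_measurable borel"
    and nn: "\<And>x. h x \<ge> 0" and hom: "\<And>c x. c > 0 \<Longrightarrow> h (c *\<^sub>R x) = c ^ j * h x"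
    and fin: "(\<integral>\<^sup>+x. ennreal (h x) * indicator {x. (norm x)\<^sup>2 \<le> 1} x \<partial>lborel) = ennreal V" and V: "V \<ge> 0"
  defines "D \<equiv> (real DIM('a) + real j) / 2"
  shows "(\<integral>\<^sup>+x. g ((norm x)\<^sup>2) * ennreal (h x) \<partial>lborel) =
     ennreal (D * V) * (\<integral>\<^sup>+s. g s * ennreal (indicator {0<..} s * s powr (D - 1)) \<partial>lborel)"
proof -
  have D: "D > 0" by (simp add: D_def add_pos_nonneg)
  define M where "M = distr (density lborel (\<lambda>x. ennreal (h x))) borel (\<lambda>x. (norm x)\<^sup>2)"
  define N where "N = density lborel (\<lambda>s. ennreal (D * V * (indicator {0<..} s * s powr (D - 1))))"
  have emM: "emeasure M {..s} = (\<integral>\<^sup>+x. ennreal (h x) * indicator {x. (norm x)\<^sup>2 \<le> s} x \<partial>lborel)" for s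
    unfolding M_def by (subst emeasure_distr, simp, simp, subst emeasure_density)
      (auto simp: vimage_def intro!: nn_integral_cong)
  have M: "emeasure M {..s} = ennreal (if s > 0 then s powr D * V else 0)" for s
  proof (cases "s > 0")
    case True
    define c where "c = sqrt s"
    have c: "c > 0" "c\<^sup>2 = s" using True by (auto simp: c_def)
    have "emeasure M {..s} = ennreal (c ^ DIM('a)) *
        (\<integral>\<^sup>+x. ennreal (h (c *\<^sub>R x)) * indicator {x. (norm x)\<^sup>2 \<le> s} (c *\<^sub>R x) \<partial>lborel)"
      unfolding emM by (rule nn_integral_scaleR) (use c in auto)
    also have "(\<lambda>x. ennreal (h (c *\<^sub>R x)) * indicator {x. (norm x)\<^sup>2 \<le> s} (c *\<^sub>R x)) =
        (\<lambda>x. ennreal (c ^ j) * (ennreal (h x) * indicator {x. (norm x)\<^sup>2 \<le> 1} x))"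
    proof
      fix x :: 'a
      have "(norm (c *\<^sub>R x))\<^sup>2 \<le> s \<longleftrightarrow> (norm x)\<^sup>2 \<le> 1"
        using c True by (simp add: power_mult_distrib)
      then show "ennreal (h (c *\<^sub>R x)) * indicator {x. (norm x)\<^sup>2 \<le> s} (c *\<^sub>R x) =
        ennreal (c ^ j) * (ennreal (h x) * indicator {x. (norm x)\<^sup>2 \<le> 1} x)"
        using c nn hom by (simp add: indicator_def ennreal_mult)
    qed
    also have "(\<integral>\<^sup>+x. ennreal (c ^ j) * (ennreal (h x) * indicator {x. (norm x)\<^sup>2 \<le> 1} x) \<partial>lborel) =
        ennreal (c ^ j) * ennreal V"
      by (subst nn_integral_cmult) (auto simp: fin)
    also have "ennreal (c ^ DIM('a)) * \<dots> = ennreal (c ^ (DIM('a) + j) * V)"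
      using c V by (simp add: ennreal_mult power_add mult.assoc)
    also have "c ^ (DIM('a) + j) = s powr D"
    proof -
      have "c = s powr (1/2)" using True by (simp add: c_def powr_half_sqrt)
      then have "c ^ (DIM('a) + j) = (s powr (1/2)) powr real (DIM('a) + j)"
        using True powr_realpow[of "s powr (1/2)" "DIM('a) + j"] by simp
      then show ?thesis by (simp add: powr_powr D_def add_divide_distrib)
    qed
    finally show ?thesis using True by simp
  next
    case False
    have "emeasure M {..s} = (\<integral>\<^sup>+x. 0 \<partial>(lborel :: 'a measure))"
      unfolding emM
    proof (rule nn_integral_cong_AE)
      have "AE x in (lborel :: 'a measure). x \<noteq> 0"
        by (rule AE_lborel_singleton)
      then show "AE x in (lborel :: 'a measure). ennreal (h x) * indicator {x. (norm x)\<^sup>2 \<le> s} x = 0"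
      proof eventually_elim
        case (elim x)
        then have "(norm x)\<^sup>2 > 0" by simp
        then have "\<not> (norm x)\<^sup>2 \<le> s" using False by linarith
        then show ?case by (simp add: indicator_def)
      qed
    qed
    then show ?thesis using False by simp
  qed
  have N: "emeasure N {..s} = ennreal (if s > 0 then s powr D * V else 0)" for s
  proof -
    have "emeasure N {..s} = (\<integral>\<^sup>+t. ennreal (D * V * (indicator {0<..} t * t powr (D - 1))) * indicator {..s} t \<partial>lborel)"
      unfolding N_def by (subst emeasure_density) auto
    also have "\<dots> = (\<integral>\<^sup>+t. ennreal (D * V) * ennreal (indicator {0<..s} t * t powr (D - 1)) \<partial>lborel)"
      using D V by (intro nn_integral_cong) (auto simp: indicator_def ennreal_mult)
    also have "\<dots> = ennreal (D * V) * (\<integral>\<^sup>+t. ennreal (indicator {0<..s} t * t powr (D - 1)) \<partial>lborel)"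
      by (rule nn_integral_cmult) auto
    also have "\<dots> = ennreal (if s > 0 then s powr D * V else 0)"
    proof (cases "s > 0")
      case True
      then show ?thesis
        using D V by (simp add: nn_integral_powr_Ioc flip: ennreal_mult)
    next
      case False
      then have "{0<..s} = {}" by auto
      then show ?thesis using False by simp
    qed
    finally show ?thesis .
  qed
  have "M = N"
  proof (rule measure_eqI_generator_eq[where E = "range (\<lambda>a::real. {..a})" and \<Omega> = UNIV and A = "\<lambda>i. {..real i}"])
    show "Int_stable (range (\<lambda>a::real. {..a}))"
      by (auto simp: Int_stable_def intro!: image_eqI[of _ _ "min _ _"])
    have "sets (borel :: real measure) = sigma_sets UNIV (range (\<lambda>a. {..a}))"
      by (subst borel_eq_atMost) simp
    then show "sets M = sigma_sets UNIV (range (\<lambda>a. {..a}))" "sets N = sigma_sets UNIV (range (\<lambda>a. {..a}))"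
      by (simp_all add: M_def N_def)
    show "(\<Union>i. {..real i}) = UNIV" using real_arch_simple by auto
  qed (auto simp: M N)
  have "(\<integral>\<^sup>+x. g ((norm x)\<^sup>2) * ennreal (h x) \<partial>lborel) = (\<integral>\<^sup>+s. g s \<partial>M)"
    unfolding M_def by (simp add: nn_integral_distr nn_integral_density mult.commute)
  also have "\<dots> = (\<integral>\<^sup>+s. ennreal (D * V * (indicator {0<..} s * s powr (D - 1))) * g s \<partial>lborel)"
    unfolding \<open>M = N\<close> N_def by (simp add: nn_integral_density)
  also have "\<dots> = (\<integral>\<^sup>+s. ennreal (D * V) * (g s * ennreal (indicator {0<..} s * s powr (D - 1))) \<partial>lborel)"
    using D V by (intro nn_integral_cong) (auto simp: ennreal_mult mult_ac)
  also have "\<dots> = ennreal (D * V) * (\<integral>\<^sup>+s. g s * ennreal (indicator {0<..} s * s powr (D - 1)) \<partial>lborel)"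
    by (rule nn_integral_cmult) auto
  finally show ?thesis .
qed

lemma nn_integral_gaussian_linear:
  fixes c :: real
  shows "(\<integral>\<^sup>+t. ennreal (exp (- t\<^sup>2 + c * t)) \<partial>lborel) = ennreal (sqrt pi * exp (c\<^sup>2 / 4))"
proof -
  define \<sigma> :: real where "\<sigma> = sqrt (1/2)"
  have \<sigma>: "\<sigma>\<^sup>2 = 1/2" "\<sigma> > 0" by (auto simp: \<sigma>_def)
  have "exp (- t\<^sup>2 + c * t) = sqrt pi * exp (c\<^sup>2 / 4) * normal_density (c/2) \<sigma> t" for t
  proof -
    have "- t\<^sup>2 + c * t = c\<^sup>2 / 4 + - (t - c/2)\<^sup>2"
      by (simp add: power2_eq_square field_simps)
    then show ?thesis
      by (simp only: exp_add) (simp add: normal_density_def \<sigma>)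
  qed
  then have "(\<integral>\<^sup>+t. ennreal (exp (- t\<^sup>2 + c * t)) \<partial>lborel) =
      (\<integral>\<^sup>+t. ennreal (sqrt pi * exp (c\<^sup>2 / 4)) * ennreal (normal_density (c/2) \<sigma> t) \<partial>lborel)"
    by (simp add: ennreal_mult)
  also have "\<dots> = ennreal (sqrt pi * exp (c\<^sup>2 / 4)) * (\<integral>\<^sup>+t. ennreal (normal_density (c/2) \<sigma> t) \<partial>lborel)"
    by (rule nn_integral_cmult) auto
  also have "(\<integral>\<^sup>+t. ennreal (normal_density (c/2) \<sigma> t) \<partial>lborel) = ennreal 1"
    using \<sigma> by (subst nn_integral_eq_integral) auto
  finally show ?thesis by simp
qed

lemma nn_integral_gaussian_mgf:
  fixes \<xi> :: "'a::euclidean_space"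
  shows "(\<integral>\<^sup>+x. ennreal (exp (- (norm x)\<^sup>2 + \<xi> \<bullet> x)) \<partial>lborel) =
     ennreal (sqrt pi ^ DIM('a) * exp ((norm \<xi>)\<^sup>2 / 4))"
proof -
  have norm2: "(norm (x :: 'a))\<^sup>2 = (\<Sum>b\<in>Basis. (x \<bullet> b)\<^sup>2)" for x
    unfolding power2_norm_eq_inner by (subst euclidean_inner) (simp add: power2_eq_square)
  have "exp (- (norm x)\<^sup>2 + \<xi> \<bullet> x) = (\<Prod>b\<in>Basis. exp (- (x \<bullet> b)\<^sup>2 + (\<xi> \<bullet> b) * (x \<bullet> b)))" for x
    by (simp add: norm2 euclidean_inner[of \<xi> x] sum_subtractf flip: exp_sum)
  then have "(\<integral>\<^sup>+x. ennreal (exp (- (norm x)\<^sup>2 + \<xi> \<bullet> x)) \<partial>lborel) =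
     (\<integral>\<^sup>+x. (\<Prod>b\<in>Basis. ennreal (exp (- (x \<bullet> b)\<^sup>2 + (\<xi> \<bullet> b) * (x \<bullet> b)))) \<partial>lborel)"
    by (simp add: prod_ennreal)
  also have "\<dots> = (\<Prod>b\<in>Basis. (\<integral>\<^sup>+t. ennreal (exp (- t\<^sup>2 + (\<xi> \<bullet> b) * t)) \<partial>lborel))"
    by (rule nn_integral_lborel_prod) auto
  also have "\<dots> = ennreal (\<Prod>b\<in>Basis. sqrt pi * exp ((\<xi> \<bullet> b)\<^sup>2 / 4))"
    unfolding nn_integral_gaussian_linear by (simp add: prod_ennreal)
  also have "(\<Prod>b\<in>Basis. sqrt pi * exp ((\<xi> \<bullet> b)\<^sup>2 / 4)) = sqrt pi ^ DIM('a) * exp ((norm \<xi>)\<^sup>2 / 4)"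
    by (simp add: prod.distrib norm2 sum_divide_distrib flip: exp_sum)
  finally show ?thesis .
qed

lemma cosh_sums: "(\<lambda>k. x ^ (2 * k) / fact (2 * k)) sums cosh (x :: real)"
proof -
  have "(\<lambda>n. if even n then x ^ n /\<^sub>R fact n else 0) sums cosh x" by (rule cosh_converges)
  then have "(\<lambda>k. (if even (2 * k) then x ^ (2 * k) /\<^sub>R fact (2 * k) else 0)) sums cosh x"
    by (subst sums_mono_reindex[of "\<lambda>k. 2 * k"]) (auto simp: strict_mono_def elim!: evenE)
  then show ?thesis by (simp add: field_simps)
qed

text \<open>The moment generating function of the Gaussian factors over the coordinates. Averaging
  it over \<open>\<plusminus> \<tau> *\<^sub>R \<xi>\<close> gives the integral of
  \<open>exp (- \<parallel>x\<parallel>\<^sup>2) * cosh (\<tau> * (\<xi> \<bullet> x))\<close>, and the moments are the coefficients of its power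
  series in \<open>\<tau>\<^sup>2\<close>.\<close>

lemma nn_integral_gaussian_moment:
  fixes \<xi> :: "'a::euclidean_space"
  shows "(\<integral>\<^sup>+x. ennreal (exp (- (norm x)\<^sup>2) * (\<xi> \<bullet> x) ^ (2 * k)) \<partial>lborel) =
     ennreal (sqrt pi ^ DIM('a) * (norm \<xi>) ^ (2 * k) * fact (2 * k) / (4 ^ k * fact k))"
proof -
  define P where "P = sqrt pi ^ DIM('a)"
  define m where "m k = (\<integral>\<^sup>+x. ennreal (exp (- (norm x)\<^sup>2) * (\<xi> \<bullet> x) ^ (2 * k)) \<partial>lborel)" for k
  have pow: "(a::real) ^ (2 * k) \<ge> 0" for a k by (simp add: power_mult)
  have sum: "(\<Sum>k. ennreal (\<tau> ^ (2 * k) / fact (2 * k)) * m k) = ennreal (P * exp (\<tau>\<^sup>2 * (norm \<xi>)\<^sup>2 / 4))" for \<tau> :: real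
  proof -
    define E where "E = P * exp (\<tau>\<^sup>2 * (norm \<xi>)\<^sup>2 / 4)"
    have E: "E \<ge> 0" by (simp add: E_def P_def)
    have "(\<Sum>k. ennreal (\<tau> ^ (2 * k) / fact (2 * k)) * m k) =
        (\<Sum>k. \<integral>\<^sup>+x. ennreal (\<tau> ^ (2 * k) / fact (2 * k)) * ennreal (exp (- (norm x)\<^sup>2) * (\<xi> \<bullet> x) ^ (2 * k)) \<partial>lborel)"
      unfolding m_def by (subst nn_integral_cmult) auto
    also have "\<dots> = (\<integral>\<^sup>+x. (\<Sum>k. ennreal (\<tau> ^ (2 * k) / fact (2 * k)) * ennreal (exp (- (norm x)\<^sup>2) * (\<xi> \<bullet> x) ^ (2 * k))) \<partial>lborel)"
      by (rule nn_integral_suminf[symmetric]) auto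
    also have "\<dots> = (\<integral>\<^sup>+x. ennreal (1/2) * (ennreal (exp (- (norm x)\<^sup>2 + (\<tau> *\<^sub>R \<xi>) \<bullet> x)) + ennreal (exp (- (norm x)\<^sup>2 + (- \<tau> *\<^sub>R \<xi>) \<bullet> x))) \<partial>lborel)"
    proof (rule nn_integral_cong)
      fix x :: 'a
      have "(\<Sum>k. ennreal (\<tau> ^ (2 * k) / fact (2 * k)) * ennreal (exp (- (norm x)\<^sup>2) * (\<xi> \<bullet> x) ^ (2 * k))) =
         (\<Sum>k. ennreal (exp (- (norm x)\<^sup>2) * ((\<tau> * (\<xi> \<bullet> x)) ^ (2 * k) / fact (2 * k))))"
      proof (rule suminf_cong)
        fix k
        have "ennreal (\<tau> ^ (2 * k) / fact (2 * k)) * ennreal (exp (- (norm x)\<^sup>2) * (\<xi> \<bullet> x) ^ (2 * k)) =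
            ennreal (\<tau> ^ (2 * k) / fact (2 * k) * (exp (- (norm x)\<^sup>2) * (\<xi> \<bullet> x) ^ (2 * k)))"
          by (rule ennreal_mult'[symmetric]) (simp add: pow)
        then show "ennreal (\<tau> ^ (2 * k) / fact (2 * k)) * ennreal (exp (- (norm x)\<^sup>2) * (\<xi> \<bullet> x) ^ (2 * k)) =
            ennreal (exp (- (norm x)\<^sup>2) * ((\<tau> * (\<xi> \<bullet> x)) ^ (2 * k) / fact (2 * k)))"
          by (simp add: power_mult_distrib mult_ac)
      qed
      also have "\<dots> = ennreal (exp (- (norm x)\<^sup>2) * cosh (\<tau> * (\<xi> \<bullet> x)))"
        by (intro suminf_ennreal_eq sums_mult cosh_sums) (simp add: pow)
      also have "exp (- (norm x)\<^sup>2) * cosh (\<tau> * (\<xi> \<bullet> x)) =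
          1/2 * (exp (- (norm x)\<^sup>2 + (\<tau> *\<^sub>R \<xi>) \<bullet> x) + exp (- (norm x)\<^sup>2 + (- \<tau> *\<^sub>R \<xi>) \<bullet> x))"
        unfolding exp_add by (simp add: cosh_field_def algebra_simps flip: exp_minus)
      also have "ennreal \<dots> = ennreal (1/2) * (ennreal (exp (- (norm x)\<^sup>2 + (\<tau> *\<^sub>R \<xi>) \<bullet> x)) + ennreal (exp (- (norm x)\<^sup>2 + (- \<tau> *\<^sub>R \<xi>) \<bullet> x)))"
        by (subst ennreal_mult) (auto simp: ennreal_plus)
      finally show "(\<Sum>k. ennreal (\<tau> ^ (2 * k) / fact (2 * k)) * ennreal (exp (- (norm x)\<^sup>2) * (\<xi> \<bullet> x) ^ (2 * k))) = \<dots>" .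
    qed
    also have "\<dots> = ennreal (1/2) * (ennreal (P * exp ((norm (\<tau> *\<^sub>R \<xi>))\<^sup>2 / 4)) + ennreal (P * exp ((norm (- \<tau> *\<^sub>R \<xi>))\<^sup>2 / 4)))"
      unfolding P_def nn_integral_gaussian_mgf[symmetric]
      by (simp add: nn_integral_cmult nn_integral_add)
    also have "\<dots> = ennreal (1/2) * (ennreal E + ennreal E)"
      by (simp add: E_def power_mult_distrib)
    also have "\<dots> = ennreal (1/2 * (E + E))"
      using E by (simp only: ennreal_plus[symmetric] ennreal_mult'[symmetric])
    finally show ?thesis by (simp add: E_def)
  qed
  have fin: "m k < top" for k
  proof -
    have "ennreal (1 ^ (2 * k) / fact (2 * k)) * m k \<le> (\<Sum>k. ennreal (1 ^ (2 * k) / fact (2 * k)) * m k)"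
      by (rule ennreal_suminf_lessD[THEN less_imp_le, rotated, of _ _ ] sum_le_suminf[of _ "{k}", simplified]) auto
    also have "\<dots> < top" unfolding sum by simp
    finally show ?thesis by (auto simp: ennreal_mult_less_top)
  qed
  define r where "r k = enn2real (m k)" for k
  have r: "m k = ennreal (r k)" "r k \<ge> 0" for k
    using fin by (auto simp: r_def)
  have "(\<lambda>k. (r k / fact (2 * k) - P * ((norm \<xi>)\<^sup>2 / 4) ^ k / fact k) * y ^ k) sums 0" if "y > 0" for y
  proof -
    define \<tau> where "\<tau> = sqrt y"
    have \<tau>: "\<tau>\<^sup>2 = y" using that by (simp add: \<tau>_def)
    have "(\<Sum>k. ennreal (r k / fact (2 * k) * y ^ k)) = ennreal (P * exp (y * (norm \<xi>)\<^sup>2 / 4))"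
      using sum[of \<tau>] unfolding r(1) power_mult \<tau>
      using r(2) that by (simp add: ennreal_mult'[symmetric] mult_ac)
    then have "(\<lambda>k. r k / fact (2 * k) * y ^ k) sums (P * exp (y * (norm \<xi>)\<^sup>2 / 4))"
      using that r(2)
      by (subst sums_ennreal[symmetric]) (auto simp: P_def sums_iff simp del: sums_ennreal suminf_ennreal)
    moreover have "(\<lambda>k. P * ((norm \<xi>)\<^sup>2 / 4) ^ k / fact k * y ^ k) sums (P * exp (y * (norm \<xi>)\<^sup>2 / 4))"
      using sums_mult[OF exp_converges[of "y * (norm \<xi>)\<^sup>2 / 4"], of P]
      by (simp add: field_simps power_mult_distrib power_divide)
    ultimately show ?thesis
      using sums_diff by (fastforce simp: left_diff_distrib)
  qed
  from powser_eq_0_imp_coeff_eq_0[OF this, of k]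
  have "r k = P * (norm \<xi>) ^ (2 * k) * fact (2 * k) / (4 ^ k * fact k)"
    by (simp add: field_simps power_divide flip: power_mult)
  then show ?thesis using r(1)[of k] by (simp add: m_def P_def)
qed

text \<open>The weight \<open>(\<xi> \<bullet> x)\<^bsup>2 k\<^esup>\<close> is homogeneous of degree \<open>2 * k\<close>, so the moment is
  \<open>D * V\<close> times a Mellin transform of \<open>g\<close>, with a constant \<open>D * V\<close> that is independent of
  \<open>g\<close>. The Gaussian, with Mellin transform \<open>Gamma D\<close>, determines it.\<close>

lemma nn_integral_radial_moment:
  fixes \<xi> :: "'a::euclidean_space" and g :: "real \<Rightarrow> ennreal"
  assumes [measurable]: "g \<in> borel_measurable borel"
  shows "(\<integral>\<^sup>+x. g ((norm x)\<^sup>2) * ennreal ((\<xi> \<bullet> x) ^ (2 * k)) \<partial>lborel) =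
     ennreal (sqrt pi ^ DIM('a) * (norm \<xi>) ^ (2 * k) * fact (2 * k) /
        (4 ^ k * fact k * Gamma (real DIM('a) / 2 + real k))) *
     (\<integral>\<^sup>+s. g s * ennreal (indicator {0<..} s * s powr (real DIM('a) / 2 + real k - 1)) \<partial>lborel)"
proof -
  define D where "D = real DIM('a) / 2 + real k"
  have D: "D > 0" by (simp add: D_def add_pos_nonneg)
  have G: "Gamma D > 0" using D by (rule Gamma_real_pos)
  let ?h = "\<lambda>x. (\<xi> \<bullet> x) ^ (2 * k)"
  let ?U = "\<integral>\<^sup>+x. ennreal (?h x) * indicator {x. (norm x)\<^sup>2 \<le> 1} x \<partial>lborel"
  have "?U \<le> (\<integral>\<^sup>+x. ennreal (exp 1) * ennreal (exp (- (norm x)\<^sup>2) * ?h x) \<partial>lborel)"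
  proof (rule nn_integral_mono)
    fix x :: 'a
    have h: "?h x \<ge> 0" by (simp add: power_mult)
    show "ennreal (?h x) * indicator {x. (norm x)\<^sup>2 \<le> 1} x \<le> ennreal (exp 1) * ennreal (exp (- (norm x)\<^sup>2) * ?h x)"
    proof (cases "(norm x)\<^sup>2 \<le> 1")
      case True
      then have "1 * ?h x \<le> exp (1 + - (norm x)\<^sup>2) * ?h x"
        by (intro mult_right_mono h) simp
      then have "?h x \<le> exp 1 * (exp (- (norm x)\<^sup>2) * ?h x)"
        unfolding exp_add by (simp add: mult.assoc)
      then show ?thesis using True h by (simp add: ennreal_leI flip: ennreal_mult')
    qed simp
  qed
  also have "\<dots> = ennreal (exp 1) * (\<integral>\<^sup>+x. ennreal (exp (- (norm x)\<^sup>2) * ?h x) \<partial>lborel)"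
    by (rule nn_integral_cmult) auto
  also have "\<dots> < top"
    unfolding nn_integral_gaussian_moment by (simp add: ennreal_mult_less_top)
  finally obtain V where V: "?U = ennreal V" "V \<ge> 0"
    by (cases ?U) auto
  have rad: "(\<integral>\<^sup>+x. g ((norm x)\<^sup>2) * ennreal (?h x) \<partial>lborel) =
     ennreal (D * V) * (\<integral>\<^sup>+s. g s * ennreal (indicator {0<..} s * s powr (D - 1)) \<partial>lborel)"
    if "g \<in> borel_measurable borel" for g :: "real \<Rightarrow> ennreal"
  proof -
    have "?h (c *\<^sub>R x) = c ^ (2 * k) * ?h x" for c x by (simp add: power_mult_distrib)
    moreover have "(real DIM('a) + real (2 * k)) / 2 = D" by (simp add: D_def)
    ultimately show ?thesis
      using nn_integral_radial_homogeneous[of ?h g "2 * k" V] V that by (simp add: power_mult)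
  qed
  have "ennreal (sqrt pi ^ DIM('a) * (norm \<xi>) ^ (2 * k) * fact (2 * k) / (4 ^ k * fact k)) =
      (\<integral>\<^sup>+x. ennreal (exp (- (norm x)\<^sup>2)) * ennreal (?h x) \<partial>lborel)"
    by (simp add: nn_integral_gaussian_moment[symmetric] ennreal_mult')
  also have "\<dots> = ennreal (D * V) * (\<integral>\<^sup>+s. ennreal (exp (- s)) * ennreal (indicator {0<..} s * s powr (D - 1)) \<partial>lborel)"
    by (rule rad) auto
  also have "(\<integral>\<^sup>+s. ennreal (exp (- s)) * ennreal (indicator {0<..} s * s powr (D - 1)) \<partial>lborel) = ennreal (Gamma D)"
    unfolding nn_integral_Gamma[OF D, symmetric]
    by (intro nn_integral_cong) (simp add: ennreal_mult'[symmetric] mult_ac)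
  also have "ennreal (D * V) * ennreal (Gamma D) = ennreal (D * V * Gamma D)"
    using D V G by (simp add: ennreal_mult)
  finally have "sqrt pi ^ DIM('a) * (norm \<xi>) ^ (2 * k) * fact (2 * k) / (4 ^ k * fact k) = D * V * Gamma D"
    using D V G by (subst (asm) ennreal_inj) auto
  then have "D * V = sqrt pi ^ DIM('a) * (norm \<xi>) ^ (2 * k) * fact (2 * k) / (4 ^ k * fact k * Gamma D)"
    using G by (simp add: field_simps)
  then show ?thesis using rad[OF assms] by (simp add: D_def)
qed

text \<open>Integrate the cosine series term by term. The factor \<open>fact (2 * k)\<close> of the moment cancels
  the one in the cosine series.\<close>

lemma cos_transform_radial:
  fixes \<xi> :: "'a::euclidean_space" and g :: "real \<Rightarrow> real"
  defines "n \<equiv> real DIM('a) / 2"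
  assumes [measurable]: "g \<in> borel_measurable borel"
    and nn: "\<And>s. g s \<ge> 0"
    and m: "\<And>k. (\<integral>\<^sup>+s. ennreal (g s) * ennreal (indicator {0<..} s * s powr (n + real k - 1)) \<partial>lborel) = ennreal (m k)"
       "\<And>k. m k \<ge> 0"
    and sum: "summable (\<lambda>k. m k / (Gamma (n + real k) * fact k) * ((norm \<xi>)\<^sup>2 / 4) ^ k)"
  shows "integrable lborel (\<lambda>x::'a. g ((norm x)\<^sup>2))" (is ?int)
    and "(\<lambda>k. sqrt pi ^ DIM('a) * (m k / (Gamma (n + real k) * fact k)) * (- ((norm \<xi>)\<^sup>2 / 4)) ^ k) sums
       (LINT x|lborel. g ((norm x)\<^sup>2) * cos (\<xi> \<bullet> x))" (is ?sums)
proof -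
  define P where "P = sqrt pi ^ DIM('a)"
  have n: "n > 0" by (simp add: n_def)
  have G: "Gamma (n + real k) > 0" for k using n by (intro Gamma_real_pos) auto
  have mom: "(\<integral>\<^sup>+x. ennreal (g ((norm x)\<^sup>2)) * ennreal ((\<zeta> \<bullet> x) ^ (2 * k)) \<partial>lborel) =
      ennreal (P * (norm \<zeta>) ^ (2 * k) * fact (2 * k) / (4 ^ k * fact k * Gamma (n + real k)) * m k)" for k and \<zeta> :: 'a
  proof -
    have "(\<integral>\<^sup>+x. ennreal (g ((norm x)\<^sup>2)) * ennreal ((\<zeta> \<bullet> x) ^ (2 * k)) \<partial>lborel) =
        ennreal (P * (norm \<zeta>) ^ (2 * k) * fact (2 * k) / (4 ^ k * fact k * Gamma (n + real k))) * ennreal (m k)"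
      using nn_integral_radial_moment[of "\<lambda>s. ennreal (g s)" \<zeta> k]
      unfolding n_def[symmetric] m(1) P_def by simp
    also have "\<dots> = ennreal (P * (norm \<zeta>) ^ (2 * k) * fact (2 * k) / (4 ^ k * fact k * Gamma (n + real k)) * m k)"
      by (rule ennreal_mult[symmetric]) (use G[of k] m(2)[of k] in \<open>auto simp: P_def intro!: divide_nonneg_nonneg\<close>)
    finally show ?thesis .
  qed
  show ?int
  proof (rule integrableI_nonneg)
    show "(\<integral>\<^sup>+x. ennreal (g ((norm (x::'a))\<^sup>2)) \<partial>lborel) < \<infinity>"
      using mom[of 0 0] by simp
  qed (auto simp: nn)
  define F where "F k x = g ((norm x)\<^sup>2) * ((-1) ^ k / fact (2 * k) * (\<xi> \<bullet> x) ^ (2 * k))" for k x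
  define I where "I k = P * (m k / (Gamma (n + real k) * fact k)) * ((norm \<xi>)\<^sup>2 / 4) ^ k" for k
  have bi: "has_bochner_integral lborel (\<lambda>x. g ((norm x)\<^sup>2) * (\<xi> \<bullet> x) ^ (2 * k)) (fact (2 * k) * I k)" for k
  proof (rule has_bochner_integral_nn_integral)
    show "0 \<le> fact (2 * k) * I k"
      using m(2)[of k] G[of k] by (simp add: I_def P_def)
    have "ennreal (g ((norm x)\<^sup>2) * (\<xi> \<bullet> x) ^ (2 * k)) = ennreal (g ((norm x)\<^sup>2)) * ennreal ((\<xi> \<bullet> x) ^ (2 * k))" for x
      by (simp add: ennreal_mult' nn)
    moreover have "P * (norm \<xi>) ^ (2 * k) * fact (2 * k) / (4 ^ k * fact k * Gamma (n + real k)) * m k = fact (2 * k) * I k"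
      by (simp add: I_def power_divide mult_ac flip: power_mult)
    ultimately show "(\<integral>\<^sup>+x. ennreal (g ((norm x)\<^sup>2) * (\<xi> \<bullet> x) ^ (2 * k)) \<partial>lborel) = ennreal (fact (2 * k) * I k)"
      using mom[of \<xi> k] by (simp only:)
  qed (auto simp: nn power_mult)
  have F: "has_bochner_integral lborel (F k) ((-1) ^ k * I k)" for k
    using has_bochner_integral_mult_right[OF bi[of k], of "(-1) ^ k / fact (2 * k)"]
    by (simp add: F_def[abs_def] mult_ac)
  have nF: "has_bochner_integral lborel (\<lambda>x. norm (F k x)) (I k)" for k
    using has_bochner_integral_mult_right[OF bi[of k], of "1 / fact (2 * k)"]
    by (simp add: F_def[abs_def] abs_mult nn power_mult mult_ac)
  have "(\<lambda>k. integral\<^sup>L lborel (F k)) sums (\<integral>x. (\<Sum>k. F k x) \<partial>lborel)"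
  proof (rule sums_integral)
    show "integrable lborel (F k)" for k by (rule integrable.intros[OF F])
    show "AE x in lborel. summable (\<lambda>k. norm (F k x))"
    proof (rule AE_I2)
      fix x :: 'a
      have "norm (F k x) = g ((norm x)\<^sup>2) * ((\<xi> \<bullet> x) ^ (2 * k) / fact (2 * k))" for k
        by (simp add: F_def abs_mult nn power_mult)
      then show "summable (\<lambda>k. norm (F k x))"
        using summable_mult[OF sums_summable[OF cosh_sums[of "\<xi> \<bullet> x"]], of "g ((norm x)\<^sup>2)"] by simp
    qed
    have "(\<integral>x. norm (F k x) \<partial>lborel) = I k" for k by (rule has_bochner_integral_integral_eq[OF nF])
    then show "summable (\<lambda>k. \<integral>x. norm (F k x) \<partial>lborel)"
      using summable_mult[OF sum, of P] by (simp add: I_def mult.assoc)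
  qed
  moreover have "(\<Sum>k. F k x) = g ((norm x)\<^sup>2) * cos (\<xi> \<bullet> x)" for x
    unfolding F_def using sums_mult[OF cos_paired[of "\<xi> \<bullet> x"], of "g ((norm x)\<^sup>2)"] by (simp add: sums_iff)
  moreover have "integral\<^sup>L lborel (F k) = P * (m k / (Gamma (n + real k) * fact k)) * (- ((norm \<xi>)\<^sup>2 / 4)) ^ k" for k
    using has_bochner_integral_integral_eq[OF F[of k]] unfolding I_def power_minus[of "(norm \<xi>)\<^sup>2 / 4"]
    by (simp add: mult_ac)
  ultimately show ?sums by (simp add: P_def)
qed

lemma cos_transform_gaussian:
  fixes \<xi> :: "'a::euclidean_space"
  shows "integrable lborel (\<lambda>x::'a. exp (- (norm x)\<^sup>2))"
    and "(LINT x|lborel. exp (- (norm x)\<^sup>2) * cos (\<xi> \<bullet> x)) = sqrt pi ^ DIM('a) * exp (- ((norm \<xi>)\<^sup>2 / 4))"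
proof -
  let ?n = "real DIM('a) / 2"
  have G: "Gamma (?n + real k) > 0" for k by (intro Gamma_real_pos) (simp add: add_pos_nonneg)
  have "(\<integral>\<^sup>+s. ennreal (exp (- s)) * ennreal (indicator {0<..} s * s powr (?n + real k - 1)) \<partial>lborel) =
      ennreal (Gamma (?n + real k))" for k
    unfolding nn_integral_Gamma[of "?n + real k", symmetric]
    by (subst nn_integral_Gamma[symmetric])
       (auto simp: ennreal_mult'[symmetric] mult_ac add_pos_nonneg intro!: nn_integral_cong)
  note * = cos_transform_radial[of "\<lambda>s. exp (- s)" "\<lambda>k. Gamma (?n + real k)" \<xi>, OF _ _ this]
  have eq: "Gamma (?n + real k) / (Gamma (?n + real k) * fact k) = 1 / fact k" for k
    using G[of k] by simp
  have sm: "summable (\<lambda>k. Gamma (?n + real k) / (Gamma (?n + real k) * fact k) * ((norm \<xi>)\<^sup>2 / 4) ^ k)"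
    unfolding eq using summable_exp[of "(norm \<xi>)\<^sup>2 / 4"] by (simp add: field_simps)
  show "integrable lborel (\<lambda>x::'a. exp (- (norm x)\<^sup>2))"
    by (rule *(1)[OF _ _ _ sm]) (use G in \<open>auto intro: less_imp_le\<close>)
  have "(\<lambda>k. sqrt pi ^ DIM('a) * (1 / fact k) * (- ((norm \<xi>)\<^sup>2 / 4)) ^ k) sums
       (LINT x|lborel. exp (- (norm x)\<^sup>2) * cos (\<xi> \<bullet> x))"
    using *(2)[OF _ _ _ sm] G unfolding eq by (auto intro: less_imp_le)
  moreover have "(\<lambda>k. sqrt pi ^ DIM('a) * (1 / fact k) * (- ((norm \<xi>)\<^sup>2 / 4)) ^ k) sums
      (sqrt pi ^ DIM('a) * exp (- ((norm \<xi>)\<^sup>2 / 4)))"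
    using sums_mult[OF exp_converges[of "- ((norm \<xi>)\<^sup>2 / 4)"], of "sqrt pi ^ DIM('a)"]
    by (simp add: field_simps)
  ultimately show "(LINT x|lborel. exp (- (norm x)\<^sup>2) * cos (\<xi> \<bullet> x)) = sqrt pi ^ DIM('a) * exp (- ((norm \<xi>)\<^sup>2 / 4))"
    by (rule sums_unique2)
qed

section \<open>Strict positive definiteness from a nonnegative transform\<close>

text \<open>Induction on the number of frequencies: dividing by one of the exponentials and
  differentiating removes its term and multiplies each other coefficient by a nonzero
  number.\<close>

lemma exponential_sum_eq_0_imp_coeff_eq_0:
  fixes c :: "'i \<Rightarrow> complex" and y :: "'i \<Rightarrow> real"
  assumes "finite S" "inj_on y S" "\<delta> > 0"
    and "\<And>t. \<bar>t\<bar> < \<delta> \<Longrightarrow> (\<Sum>j\<in>S. c j * exp (\<i> * of_real (y j) * of_real t)) = 0"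
  shows "\<forall>j\<in>S. c j = 0"
  using assms
proof (induction S arbitrary: c y rule: finite_induct)
  case empty
  then show ?case by simp
next
  case (insert k S)
  define y' where "y' j = y j - y k" for j
  define g where "g s = (\<Sum>j\<in>S. c j * exp (\<i> * of_real (y' j) * s))" for s :: complex
  have const: "g (of_real t) = - c k" if "\<bar>t\<bar> < \<delta>" for t
  proof -
    have "0 = exp (- (\<i> * of_real (y k) * of_real t)) * (\<Sum>j\<in>insert k S. c j * exp (\<i> * of_real (y j) * of_real t))"
      using insert.prems(3)[OF that] by simp
    also have "\<dots> = (\<Sum>j\<in>insert k S. c j * exp (\<i> * of_real (y' j) * of_real t))"
      unfolding sum_distrib_left
      by (intro sum.cong) (auto simp: y'_def algebra_simps simp flip: exp_add)
    also have "\<dots> = c k + g (of_real t)"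
      using insert.hyps by (simp add: g_def y'_def)
    finally show ?thesis by (simp add: add_eq_0_iff)
  qed
  have "(\<Sum>j\<in>S. (c j * (\<i> * of_real (y' j))) * exp (\<i> * of_real (y' j) * of_real t)) = 0" if t: "\<bar>t\<bar> < \<delta>" for t
  proof -
    have "(g has_field_derivative (\<Sum>j\<in>S. (c j * (\<i> * of_real (y' j))) * exp (\<i> * of_real (y' j) * of_real t))) (at (of_real t))"
      unfolding g_def[abs_def] by (auto intro!: derivative_eq_intros sum.cong)
    then have "((\<lambda>t. g (of_real t)) has_vector_derivative
        (\<Sum>j\<in>S. (c j * (\<i> * of_real (y' j))) * exp (\<i> * of_real (y' j) * of_real t))) (at t)"
      by (rule has_vector_derivative_real_field)
    moreover have "((\<lambda>t. g (of_real t)) has_vector_derivative 0) (at t)"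
    proof (rule has_vector_derivative_transform_within_open)
      show "((\<lambda>t. - c k) has_vector_derivative 0) (at t)" by simp
      show "open {-\<delta><..<\<delta>}" "t \<in> {-\<delta><..<\<delta>}" using t by auto
    qed (use const in auto)
    ultimately show ?thesis by (rule vector_derivative_unique_at)
  qed
  moreover have "inj_on y' S" using insert.prems(1) by (auto simp: inj_on_def y'_def)
  ultimately have "\<forall>j\<in>S. c j * (\<i> * of_real (y' j)) = 0"
    by (intro insert.IH[of y' "\<lambda>j. c j * (\<i> * of_real (y' j))"] insert.prems(2))
  moreover have "y' j \<noteq> 0" if "j \<in> S" for j
    using insert.prems(1) insert.hyps that by (auto simp: inj_on_def y'_def)
  ultimately have S: "\<forall>j\<in>S. c j = 0" by auto
  then have "c k = 0" using const[of 0] insert.prems(2) by (simp add: g_def)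
  with S show ?case by simp
qed

text \<open>The directions that fail lie in finitely many hyperplanes, a null set.\<close>

lemma ex_separating_direction:
  fixes x :: "'i \<Rightarrow> 'a::euclidean_space"
  assumes "finite S" "inj_on x S"
  shows "\<exists>v. inj_on (\<lambda>i. v \<bullet> x i) S"
proof -
  define D where "D = (\<lambda>(i, j). x i - x j) ` {(i, j). i \<in> S \<and> j \<in> S \<and> i \<noteq> j}"
  have "finite {(i, j). i \<in> S \<and> j \<in> S \<and> i \<noteq> j}"
    by (rule finite_subset[of _ "S \<times> S"]) (use assms in auto)
  then have D1: "finite D" by (simp add: D_def)
  have D2: "0 \<notin> D"
  proof
    assume "0 \<in> D"
    then obtain i j where "i \<in> S" "j \<in> S" "i \<noteq> j" "x i = x j" by (auto simp: D_def)
    then show False using assms(2) by (meson inj_onD)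
  qed
  have "negligible (\<Union>d\<in>D. {v. d \<bullet> v = 0})"
  proof (intro negligible_Union)
    fix N assume "N \<in> (\<lambda>d. {v. d \<bullet> v = 0}) ` D"
    then obtain d where "d \<in> D" "N = {v. d \<bullet> v = 0}" by blast
    then show "negligible N" using D2 negligible_hyperplane[of d 0] by metis
  qed (use D1 in auto)
  then have "(\<Union>d\<in>D. {v. d \<bullet> v = 0}) \<noteq> UNIV" by auto
  then obtain v where v: "\<And>d. d \<in> D \<Longrightarrow> d \<bullet> v \<noteq> 0" by auto
  have "inj_on (\<lambda>i. v \<bullet> x i) S"
  proof (rule inj_onI, rule ccontr)
    fix i j assume ij: "i \<in> S" "j \<in> S" "v \<bullet> x i = v \<bullet> x j" "i \<noteq> j"
    have "(x i - x j) \<bullet> v = v \<bullet> x i - v \<bullet> x j"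
      by (subst inner_commute) (rule inner_diff_right)
    then have "(x i - x j) \<bullet> v = 0" using ij by simp
    moreover have "x i - x j \<in> D" using ij by (auto simp: D_def)
    ultimately show False using v by blast
  qed
  then show ?thesis by blast
qed

text \<open>Restricted to a line in a separating direction, the two sums are the real and the
  imaginary part of an exponential sum with distinct frequencies.\<close>

lemma trig_sum_nonzero_near_0:
  fixes x :: "'i \<Rightarrow> 'a::euclidean_space" and c :: "'i \<Rightarrow> real"
  assumes "finite S" "inj_on x S" "\<exists>i\<in>S. c i \<noteq> 0" "r > 0"
  shows "\<exists>\<eta>. norm \<eta> < r \<and> (\<Sum>i\<in>S. c i * cos (\<eta> \<bullet> x i))\<^sup>2 + (\<Sum>i\<in>S. c i * sin (\<eta> \<bullet> x i))\<^sup>2 > 0"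
proof (rule ccontr)
  assume no: "\<not> ?thesis"
  have zero: "(\<Sum>i\<in>S. c i * cos (\<eta> \<bullet> x i)) = 0 \<and> (\<Sum>i\<in>S. c i * sin (\<eta> \<bullet> x i)) = 0" if "norm \<eta> < r" for \<eta>
  proof -
    have "\<not> (\<Sum>i\<in>S. c i * cos (\<eta> \<bullet> x i))\<^sup>2 + (\<Sum>i\<in>S. c i * sin (\<eta> \<bullet> x i))\<^sup>2 > 0"
      using no that by blast
    then show ?thesis by (simp add: sum_power2_gt_zero_iff)
  qed
  obtain v where v: "inj_on (\<lambda>i. v \<bullet> x i) S"
    using ex_separating_direction[OF assms(1,2)] by blast
  define \<delta> where "\<delta> = r / (norm v + 1)"
  have \<delta>: "\<delta> > 0" using assms(4) by (simp add: \<delta>_def add_nonneg_pos)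
  have "(\<Sum>j\<in>S. of_real (c j) * exp (\<i> * of_real (v \<bullet> x j) * of_real t)) = (0 :: complex)" if "\<bar>t\<bar> < \<delta>" for t
  proof -
    have "norm (t *\<^sub>R v) \<le> \<bar>t\<bar> * (norm v + 1)" by (simp add: algebra_simps)
    also have "\<dots> < r"
      using that by (simp add: \<delta>_def pos_less_divide_eq add_nonneg_pos)
    finally have "norm (t *\<^sub>R v) < r" .
    from zero[OF this] show ?thesis
      by (simp add: complex_eq_iff Re_exp Im_exp mult.commute)
  qed
  from exponential_sum_eq_0_imp_coeff_eq_0[OF assms(1) v \<delta> this]
  show False using assms(3) by auto
qed

lemma lborel_integral_affine_euclidean:
  fixes f :: "'a::euclidean_space \<Rightarrow> real"
  assumes [measurable]: "f \<in> borel_measurable borel" and c: "c \<noteq> 0"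
  shows "(LINT x|lborel. f x) = \<bar>c\<bar> ^ DIM('a) * (LINT x|lborel. f (t + c *\<^sub>R x))"
proof -
  have "(LINT x|lborel. f x) = (LINT x|density (distr lborel borel (\<lambda>x. t + c *\<^sub>R x)) (\<lambda>_. ennreal (\<bar>c\<bar> ^ DIM('a))). f x)"
    using lborel_affine[OF c, of t] by (simp add: ennreal_power)
  also have "\<dots> = (LINT x|distr lborel borel (\<lambda>x. t + c *\<^sub>R x). \<bar>c\<bar> ^ DIM('a) *\<^sub>R f x)"
    by (rule integral_density) auto
  also have "\<dots> = \<bar>c\<bar> ^ DIM('a) * (LINT x|lborel. f (t + c *\<^sub>R x))"
    by (subst integral_distr) auto
  finally show ?thesis .
qed

lemma lborel_integrable_scaleR:
  fixes f :: "'a::euclidean_space \<Rightarrow> real"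
  assumes f: "integrable lborel f" and c: "c \<noteq> 0"
  shows "integrable lborel (\<lambda>x. f (c *\<^sub>R x))"
proof -
  have [measurable]: "f \<in> borel_measurable borel" using f by auto
  have "integrable (density (distr lborel borel (\<lambda>x. 0 + c *\<^sub>R x)) (\<lambda>_. ennreal (\<bar>c\<bar> ^ DIM('a)))) f"
    using lborel_affine[OF c, of "0 :: 'a"] f by (simp add: ennreal_power)
  then have "integrable (distr lborel borel (\<lambda>x. 0 + c *\<^sub>R x)) (\<lambda>x. \<bar>c\<bar> ^ DIM('a) *\<^sub>R f x)"
    by (subst (asm) integrable_density) auto
  then have "integrable lborel (\<lambda>x. \<bar>c\<bar> ^ DIM('a) * f (0 + c *\<^sub>R x))"
    by (subst (asm) integrable_distr_eq) auto
  then show ?thesis using c by simp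
qed

lemma cos_transform_scaled_gaussian:
  fixes z :: "'a::euclidean_space"
  assumes "\<tau> > 0"
  shows "integrable lborel (\<lambda>\<eta>::'a. exp (- (norm ((\<tau> / 2) *\<^sub>R \<eta>))\<^sup>2))"
    and "(LINT \<eta>|lborel. exp (- (norm ((\<tau> / 2) *\<^sub>R \<eta>))\<^sup>2) * cos (\<eta> \<bullet> z)) =
       (2 * sqrt pi / \<tau>) ^ DIM('a) * exp (- (norm ((1 / \<tau>) *\<^sub>R z))\<^sup>2)"
proof -
  show "integrable lborel (\<lambda>\<eta>::'a. exp (- (norm ((\<tau> / 2) *\<^sub>R \<eta>))\<^sup>2))"
    by (rule lborel_integrable_scaleR[OF cos_transform_gaussian(1)]) (use assms in auto)
  have "sqrt pi ^ DIM('a) * exp (- (norm ((1 / \<tau>) *\<^sub>R z))\<^sup>2) =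
      (LINT x|lborel. exp (- (norm x)\<^sup>2) * cos (((2 / \<tau>) *\<^sub>R z) \<bullet> x))"
    unfolding cos_transform_gaussian(2) using assms by (simp add: power_mult_distrib power_divide)
  also have "\<dots> = \<bar>\<tau> / 2\<bar> ^ DIM('a) * (LINT \<eta>|lborel. exp (- (norm (0 + (\<tau> / 2) *\<^sub>R \<eta>))\<^sup>2) *
      cos (((2 / \<tau>) *\<^sub>R z) \<bullet> (0 + (\<tau> / 2) *\<^sub>R \<eta>)))"
    by (rule lborel_integral_affine_euclidean) (use assms in auto)
  also have "\<dots> = (\<tau> / 2) ^ DIM('a) * (LINT \<eta>|lborel. exp (- (norm ((\<tau> / 2) *\<^sub>R \<eta>))\<^sup>2) * cos (\<eta> \<bullet> z))"
    using assms by (simp add: inner_commute)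
  finally show "(LINT \<eta>|lborel. exp (- (norm ((\<tau> / 2) *\<^sub>R \<eta>))\<^sup>2) * cos (\<eta> \<bullet> z)) =
       (2 * sqrt pi / \<tau>) ^ DIM('a) * exp (- (norm ((1 / \<tau>) *\<^sub>R z))\<^sup>2)"
    using assms by (simp add: field_simps power_mult_distrib power_divide)
qed

lemma integral_even_sin_eq_0:
  fixes f :: "'a::euclidean_space \<Rightarrow> real"
  assumes [measurable]: "f \<in> borel_measurable borel" and even: "\<And>x. f (- x) = f x"
  shows "(LINT x|lborel. f x * sin (\<xi> \<bullet> x)) = 0"
proof -
  have "(LINT x|lborel. f x * sin (\<xi> \<bullet> x)) =
      \<bar>-1\<bar> ^ DIM('a) * (LINT x|lborel. f (0 + (-1) *\<^sub>R x) * sin (\<xi> \<bullet> (0 + (-1) *\<^sub>R x)))"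
    by (rule lborel_integral_affine_euclidean) auto
  then show ?thesis by (simp add: even)
qed

text \<open>The Gaussian is the transform of a Gaussian; insert this and exchange the integrals.\<close>

lemma gaussian_smoothing_eq_cos_transform:
  fixes f :: "'a::euclidean_space \<Rightarrow> real"
  assumes f: "integrable lborel f" and even: "\<And>x. f (- x) = f x" and \<tau>: "\<tau> > 0"
  defines "F \<equiv> \<lambda>\<eta>. LINT x|lborel. f x * cos (\<eta> \<bullet> x)"
  shows "(LINT \<eta>|lborel. exp (- (norm ((\<tau> / 2) *\<^sub>R \<eta>))\<^sup>2) * F \<eta> * cos (\<eta> \<bullet> u)) =
     (2 * sqrt pi) ^ DIM('a) * (LINT y|lborel. f (u + \<tau> *\<^sub>R y) * exp (- (norm y)\<^sup>2))"
proof -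
  have [measurable]: "f \<in> borel_measurable borel" using f by auto
  let ?E = "\<lambda>\<eta>::'a. exp (- (norm ((\<tau> / 2) *\<^sub>R \<eta>))\<^sup>2)"
  have E: "integrable lborel ?E" by (rule cos_transform_scaled_gaussian(1)[OF \<tau>])
  have prod: "integrable (lborel \<Otimes>\<^sub>M lborel) (\<lambda>(\<eta>, x). ?E \<eta> * f x)"
  proof (rule lborel_pair.Fubini_integrable)
    have "(LINT x|lborel. norm (?E \<eta> * f x)) = ?E \<eta> * (LINT x|lborel. \<bar>f x\<bar>)" for \<eta>
      by (simp add: abs_mult)
    then show "integrable lborel (\<lambda>\<eta>. LINT x|lborel. norm (case (\<eta>, x) of (\<eta>, x) \<Rightarrow> ?E \<eta> * f x))"
      using E by simp
  qed (use f in auto)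
  have pair: "integrable (lborel \<Otimes>\<^sub>M lborel) (\<lambda>(\<eta>, x). ?E \<eta> * f x * cos (\<eta> \<bullet> (x - u)))"
    by (rule Bochner_Integration.integrable_bound[OF prod]) (auto simp: abs_mult mult_left_le)
  have inner: "(LINT x|lborel. ?E \<eta> * f x * cos (\<eta> \<bullet> (x - u))) = ?E \<eta> * F \<eta> * cos (\<eta> \<bullet> u)" for \<eta>
  proof -
    have c: "integrable lborel (\<lambda>x. f x * cos (\<eta> \<bullet> x))"
      by (rule Bochner_Integration.integrable_bound[OF f]) (auto simp: abs_mult mult_left_le)
    have s: "integrable lborel (\<lambda>x. f x * sin (\<eta> \<bullet> x))"
      by (rule Bochner_Integration.integrable_bound[OF f]) (auto simp: abs_mult mult_left_le)
    have "?E \<eta> * f x * cos (\<eta> \<bullet> (x - u)) =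
        (?E \<eta> * cos (\<eta> \<bullet> u)) * (f x * cos (\<eta> \<bullet> x)) + (?E \<eta> * sin (\<eta> \<bullet> u)) * (f x * sin (\<eta> \<bullet> x))" for x
      by (simp add: inner_diff_right cos_diff algebra_simps)
    then have "(LINT x|lborel. ?E \<eta> * f x * cos (\<eta> \<bullet> (x - u))) =
        (?E \<eta> * cos (\<eta> \<bullet> u)) * F \<eta> + (?E \<eta> * sin (\<eta> \<bullet> u)) * (LINT x|lborel. f x * sin (\<eta> \<bullet> x))"
      using c s unfolding F_def by (simp only:) (subst Bochner_Integration.integral_add, auto)
    then show ?thesis using integral_even_sin_eq_0[of f \<eta>] even by (simp add: mult_ac)
  qed
  have "(LINT \<eta>|lborel. ?E \<eta> * F \<eta> * cos (\<eta> \<bullet> u)) =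
      (LINT \<eta>|lborel. LINT x|lborel. ?E \<eta> * f x * cos (\<eta> \<bullet> (x - u)))"
    by (simp only: inner)
  also have "\<dots> = (LINT x|lborel. LINT \<eta>|lborel. ?E \<eta> * f x * cos (\<eta> \<bullet> (x - u)))"
    by (rule lborel_pair.Fubini_integral[symmetric]) (rule pair)
  also have "\<dots> = (LINT x|lborel. f x * (LINT \<eta>|lborel. ?E \<eta> * cos (\<eta> \<bullet> (x - u))))"
    by (simp add: mult_ac flip: integral_mult_right_zero)
  also have "\<dots> = (LINT x|lborel. (2 * sqrt pi / \<tau>) ^ DIM('a) * (f x * exp (- (norm ((1 / \<tau>) *\<^sub>R (x - u)))\<^sup>2)))"
    unfolding cos_transform_scaled_gaussian(2)[OF \<tau>] by (simp add: mult_ac)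
  also have "\<dots> = (2 * sqrt pi / \<tau>) ^ DIM('a) * (LINT x|lborel. f x * exp (- (norm ((1 / \<tau>) *\<^sub>R (x - u)))\<^sup>2))"
    by simp
  also have "(LINT x|lborel. f x * exp (- (norm ((1 / \<tau>) *\<^sub>R (x - u)))\<^sup>2)) =
      \<bar>\<tau>\<bar> ^ DIM('a) * (LINT y|lborel. f (u + \<tau> *\<^sub>R y) * exp (- (norm ((1 / \<tau>) *\<^sub>R (u + \<tau> *\<^sub>R y - u)))\<^sup>2))"
    by (rule lborel_integral_affine_euclidean) (use \<tau> in auto)
  finally show ?thesis using \<tau> by (simp add: power_divide)
qed

lemma tendsto_gaussian_smoothing:
  fixes f :: "'a::euclidean_space \<Rightarrow> real"
  assumes cont: "continuous_on UNIV f" and B: "\<And>x. \<bar>f x\<bar> \<le> B" and \<tau>: "\<tau> \<longlonglongrightarrow> 0"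
  shows "(\<lambda>n. LINT y|lborel. f (u + \<tau> n *\<^sub>R y) * exp (- (norm y)\<^sup>2)) \<longlonglongrightarrow> sqrt pi ^ DIM('a) * f u"
proof -
  have [measurable]: "f \<in> borel_measurable borel"
    using cont by (rule borel_measurable_continuous_onI)
  have "(\<lambda>n. LINT y|lborel. f (u + \<tau> n *\<^sub>R y) * exp (- (norm y)\<^sup>2)) \<longlonglongrightarrow>
      (LINT y|lborel. f u * exp (- (norm (y :: 'a))\<^sup>2))"
  proof (rule integral_dominated_convergence[where w = "\<lambda>y. B * exp (- (norm y)\<^sup>2)"])
    show "integrable lborel (\<lambda>y::'a. B * exp (- (norm y)\<^sup>2))"
      using cos_transform_gaussian(1)[where 'a = 'a] by simp
    show "AE y in lborel. (\<lambda>n. f (u + \<tau> n *\<^sub>R y) * exp (- (norm y)\<^sup>2)) \<longlonglongrightarrow> f u * exp (- (norm y)\<^sup>2)"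
    proof (rule AE_I2)
      fix y :: 'a
      have "(\<lambda>n. u + \<tau> n *\<^sub>R y) \<longlonglongrightarrow> u + 0 *\<^sub>R y" by (intro tendsto_intros \<tau>)
      then have "(\<lambda>n. f (u + \<tau> n *\<^sub>R y)) \<longlonglongrightarrow> f u"
        using cont isCont_tendsto_compose[of u f] by (simp add: continuous_on_eq_continuous_at)
      then show "(\<lambda>n. f (u + \<tau> n *\<^sub>R y) * exp (- (norm y)\<^sup>2)) \<longlonglongrightarrow> f u * exp (- (norm y)\<^sup>2)"
        by (intro tendsto_intros)
    qed
    show "AE y in lborel. norm (f (u + \<tau> n *\<^sub>R y) * exp (- (norm y)\<^sup>2)) \<le> B * exp (- (norm y)\<^sup>2)" for n
      using B by (auto simp: abs_mult)
  qed auto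
  also have "(LINT y|lborel. f u * exp (- (norm (y :: 'a))\<^sup>2)) = sqrt pi ^ DIM('a) * f u"
    using cos_transform_gaussian(2)[of "0 :: 'a"] by simp
  finally show ?thesis .
qed

lemma continuous_cos_transform:
  fixes f :: "'a::euclidean_space \<Rightarrow> real"
  assumes f: "integrable lborel f"
  shows "continuous_on UNIV (\<lambda>\<eta>. LINT x|lborel. f x * cos (\<eta> \<bullet> x))"
proof (rule continuous_on_sequentiallyI)
  fix u :: "nat \<Rightarrow> 'a" and a assume u: "u \<longlonglongrightarrow> a"
  have [measurable]: "f \<in> borel_measurable borel" using f by auto
  show "(\<lambda>n. LINT x|lborel. f x * cos (u n \<bullet> x)) \<longlonglongrightarrow> (LINT x|lborel. f x * cos (a \<bullet> x))"
  proof (rule integral_dominated_convergence[where w = "\<lambda>x. \<bar>f x\<bar>"])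
    show "AE x in lborel. (\<lambda>n. f x * cos (u n \<bullet> x)) \<longlonglongrightarrow> f x * cos (a \<bullet> x)"
      by (intro AE_I2 tendsto_intros u)
  qed (use f in \<open>auto simp: abs_mult mult_left_le\<close>)
qed

lemma integral_pos_of_continuous:
  fixes k :: "'a::euclidean_space \<Rightarrow> real"
  assumes k: "integrable lborel k" "continuous_on UNIV k" "\<And>x. k x \<ge> 0" and "k x0 > 0"
  shows "(LINT x|lborel. k x) > 0"
proof (rule ccontr)
  assume "\<not> ?thesis"
  moreover have "(LINT x|lborel. k x) \<ge> 0" by (rule Bochner_Integration.integral_nonneg) (rule k)
  ultimately have "(LINT x|lborel. k x) = 0" by linarith
  then have "AE x in lborel. k x = 0"
    using integral_nonneg_eq_0_iff_AE[OF k(1)] k(3) by auto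
  then have "AE x in lborel. x \<notin> {x. k x \<noteq> 0}" by simp
  moreover have op: "open {x. k x \<noteq> 0}"
    using k(2) by (intro open_Collect_neq) (auto intro: continuous_intros)
  ultimately have "{x. k x \<noteq> 0} \<in> null_sets lborel"
    by (subst AE_iff_null_sets) auto
  then have "negligible {x. k x \<noteq> 0}"
    unfolding negligible_iff_null_sets by (rule null_sets_completionI)
  with op have "{x. k x \<noteq> 0} = {}" using open_not_negligible by blast
  with \<open>k x0 > 0\<close> show False by auto
qed

lemma quadratic_form_cos:
  fixes x :: "'i \<Rightarrow> 'a::real_inner" and c :: "'i \<Rightarrow> real"
  shows "(\<Sum>i\<in>S. \<Sum>j\<in>S. c i * c j * cos (\<eta> \<bullet> (x i - x j))) =
     (\<Sum>i\<in>S. c i * cos (\<eta> \<bullet> x i))\<^sup>2 + (\<Sum>i\<in>S. c i * sin (\<eta> \<bullet> x i))\<^sup>2"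
  by (simp add: inner_diff_right cos_diff power2_eq_square sum_product algebra_simps sum.distrib)

text \<open>The easy half of Bochner's theorem, with strictness. Let \<open>T \<eta>\<close> be the squared modulus of
  \<open>\<Sum>i\<in>S. c i * exp(\<i> \<eta> \<bullet> x i)\<close>. Up to a positive factor, the quadratic form of \<open>f\<close>
  smoothed at scale \<open>\<tau>\<close> is \<open>Q \<tau>\<close>, the integral of \<open>F * T\<close> against a Gaussian that increases as
  \<open>\<tau>\<close> decreases. Hence the limit at \<open>\<tau> = 0\<close>, a positive multiple of the quadratic form of
  \<open>f\<close>, is at least \<open>Q 1 > 0\<close>. The detour through \<open>Q\<close> is there because \<open>F\<close> may fail to be
  integrable, so that the inversion formula is not at hand for \<open>f\<close> itself.\<close>

theorem positive_definite_of_cos_transform: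
  fixes f :: "'a::euclidean_space \<Rightarrow> real"
  assumes f: "integrable lborel f" "continuous_on UNIV f" "\<And>x. \<bar>f x\<bar> \<le> B" and even: "\<And>x. f (- x) = f x"
  defines "F \<equiv> \<lambda>\<eta>. LINT x|lborel. f x * cos (\<eta> \<bullet> x)"
  assumes F: "\<And>\<eta>. F \<eta> \<ge> 0" "F 0 > 0"
    and S: "finite S" "inj_on x S" "\<exists>i\<in>S. c i \<noteq> 0"
  shows "(\<Sum>i\<in>S. \<Sum>j\<in>S. c i * c j * f (x i - x j)) > 0"
proof -
  define T where "T \<eta> = (\<Sum>i\<in>S. c i * cos (\<eta> \<bullet> x i))\<^sup>2 + (\<Sum>i\<in>S. c i * sin (\<eta> \<bullet> x i))\<^sup>2" for \<eta>
  have T: "T \<eta> \<ge> 0" for \<eta> by (simp add: T_def)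
  have contF: "continuous_on UNIV F" unfolding F_def by (rule continuous_cos_transform[OF f(1)])
  then have Fm[measurable]: "F \<in> borel_measurable borel" by (rule borel_measurable_continuous_onI)
  define E where "E \<tau> \<eta> = exp (- (norm ((\<tau> / 2) *\<^sub>R \<eta>))\<^sup>2)" for \<tau> and \<eta> :: 'a
  have E: "integrable lborel (E \<tau>)" if "\<tau> > 0" for \<tau>
    unfolding E_def by (rule cos_transform_scaled_gaussian(1)[OF that])
  have Em[measurable]: "E \<tau> \<in> borel_measurable borel" for \<tau> unfolding E_def[abs_def] by measurable
  define L where "L = (LINT x|lborel. \<bar>f x\<bar>)"
  have FL: "\<bar>F \<eta>\<bar> \<le> L" for \<eta>
  proof -
    have c: "integrable lborel (\<lambda>x. f x * cos (\<eta> \<bullet> x))"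
      by (rule Bochner_Integration.integrable_bound[OF f(1)]) (use f(1) in \<open>auto simp: abs_mult mult_left_le\<close>)
    have "\<bar>F \<eta>\<bar> \<le> (LINT x|lborel. \<bar>f x * cos (\<eta> \<bullet> x)\<bar>)"
      unfolding F_def by (rule integral_abs_bound)
    also have "\<dots> \<le> L"
      unfolding L_def
    proof (rule integral_mono)
      show "integrable lborel (\<lambda>x. \<bar>f x * cos (\<eta> \<bullet> x)\<bar>)" "integrable lborel (\<lambda>x. \<bar>f x\<bar>)"
        using c f(1) by (auto intro: integrable_abs)
    qed (simp add: abs_mult mult_left_le)
    finally show ?thesis .
  qed
  have EF: "integrable lborel (\<lambda>\<eta>. E \<tau> \<eta> * F \<eta> * cos (\<eta> \<bullet> u))" if "\<tau> > 0" for \<tau> u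
  proof (rule Bochner_Integration.integrable_bound)
    show "integrable lborel (\<lambda>\<eta>. E \<tau> \<eta> * L)" using E[OF that] by simp
    have "norm (E \<tau> \<eta> * F \<eta> * cos (\<eta> \<bullet> u)) \<le> norm (E \<tau> \<eta> * L)" for \<eta>
    proof -
      have "\<bar>F \<eta>\<bar> * \<bar>cos (\<eta> \<bullet> u)\<bar> \<le> \<bar>L\<bar> * 1"
        using FL[of \<eta>] by (intro mult_mono) auto
      then show ?thesis by (simp add: abs_mult E_def mult.assoc)
    qed
    then show "AE \<eta> in lborel. norm (E \<tau> \<eta> * F \<eta> * cos (\<eta> \<bullet> u)) \<le> norm (E \<tau> \<eta> * L)" by simp
  qed measurable
  define Q where "Q \<tau> = (LINT \<eta>|lborel. E \<tau> \<eta> * F \<eta> * T \<eta>)" for \<tau>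
  have decomp: "E \<tau> \<eta> * F \<eta> * T \<eta> = (\<Sum>i\<in>S. \<Sum>j\<in>S. c i * c j * (E \<tau> \<eta> * F \<eta> * cos (\<eta> \<bullet> (x i - x j))))" for \<tau> \<eta>
    unfolding T_def quadratic_form_cos[symmetric] by (simp add: sum_distrib_left mult_ac)
  have EFT: "integrable lborel (\<lambda>\<eta>. E \<tau> \<eta> * F \<eta> * T \<eta>)" if "\<tau> > 0" for \<tau>
    unfolding decomp using EF[OF that] by (intro Bochner_Integration.integrable_sum) auto
  have Q: "Q \<tau> = (2 * sqrt pi) ^ DIM('a) *
      (\<Sum>i\<in>S. \<Sum>j\<in>S. c i * c j * (LINT y|lborel. f (x i - x j + \<tau> *\<^sub>R y) * exp (- (norm y)\<^sup>2)))" if "\<tau> > 0" for \<tau>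
  proof -
    have "Q \<tau> = (\<Sum>i\<in>S. \<Sum>j\<in>S. c i * c j * (LINT \<eta>|lborel. E \<tau> \<eta> * F \<eta> * cos (\<eta> \<bullet> (x i - x j))))"
      unfolding Q_def decomp using EF[OF that]
      by (simp add: Bochner_Integration.integral_sum Bochner_Integration.integrable_sum)
    also have "\<dots> = (\<Sum>i\<in>S. \<Sum>j\<in>S. c i * c j * ((2 * sqrt pi) ^ DIM('a) *
        (LINT y|lborel. f (x i - x j + \<tau> *\<^sub>R y) * exp (- (norm y)\<^sup>2))))"
      unfolding E_def F_def gaussian_smoothing_eq_cos_transform[OF f(1) even that] ..
    finally show ?thesis by (simp add: sum_distrib_left mult_ac)
  qed
  have "Q 1 > 0"
  proof -
    have "\<exists>r>0. \<forall>\<eta>. dist \<eta> 0 < r \<longrightarrow> dist (F \<eta>) (F 0) < F 0"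
      using contF F(2) unfolding continuous_on_iff by blast
    then obtain r where r: "r > 0" "\<And>\<eta>. norm \<eta> < r \<Longrightarrow> \<bar>F \<eta> - F 0\<bar> < F 0"
      by (auto simp: dist_real_def)
    obtain \<eta>0 where \<eta>0: "norm \<eta>0 < r" "T \<eta>0 > 0"
      using trig_sum_nonzero_near_0[OF S r(1)] unfolding T_def by blast
    have "F \<eta>0 > 0" using r(2)[OF \<eta>0(1)] by linarith
    then have "E 1 \<eta>0 * F \<eta>0 * T \<eta>0 > 0" using \<eta>0 by (simp add: E_def)
    then show ?thesis unfolding Q_def
    proof (rule integral_pos_of_continuous[rotated -1])
      show "continuous_on UNIV (\<lambda>\<eta>. E 1 \<eta> * F \<eta> * T \<eta>)"
        unfolding E_def T_def by (intro continuous_intros contF)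
      show "integrable lborel (\<lambda>\<eta>. E 1 \<eta> * F \<eta> * T \<eta>)" by (rule EFT) simp
      show "E 1 \<eta> * F \<eta> * T \<eta> \<ge> 0" for \<eta> using F(1)[of \<eta>] T[of \<eta>] by (simp add: E_def)
    qed
  qed
  define \<tau> where "\<tau> n = inverse (real (Suc n))" for n
  have \<tau>: "\<tau> n > 0" "\<tau> n \<le> 1" for n by (auto simp: \<tau>_def field_simps)
  have "\<tau> \<longlonglongrightarrow> 0" unfolding \<tau>_def by (rule LIMSEQ_inverse_real_of_nat)
  then have "(\<lambda>n. Q (\<tau> n)) \<longlonglongrightarrow> (2 * sqrt pi) ^ DIM('a) *
      (\<Sum>i\<in>S. \<Sum>j\<in>S. c i * c j * (sqrt pi ^ DIM('a) * f (x i - x j)))"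
    unfolding Q[OF \<tau>(1)] by (intro tendsto_intros tendsto_gaussian_smoothing[OF f(2,3)])
  moreover have "Q 1 \<le> Q (\<tau> n)" for n
    unfolding Q_def
  proof (rule integral_mono)
    fix \<eta> :: 'a
    have "(norm ((\<tau> n / 2) *\<^sub>R \<eta>))\<^sup>2 \<le> (norm ((1 / 2) *\<^sub>R \<eta>))\<^sup>2"
      using \<tau>[of n] mult_right_mono[of "\<tau> n" 1 "norm \<eta>"] by (intro power_mono) auto
    then have "E 1 \<eta> \<le> E (\<tau> n) \<eta>" by (simp add: E_def)
    then show "E 1 \<eta> * F \<eta> * T \<eta> \<le> E (\<tau> n) \<eta> * F \<eta> * T \<eta>"
      by (intro mult_right_mono F T)
  qed (use EFT \<tau> in auto)
  ultimately have "Q 1 \<le> (2 * sqrt pi) ^ DIM('a) *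
      (\<Sum>i\<in>S. \<Sum>j\<in>S. c i * c j * (sqrt pi ^ DIM('a) * f (x i - x j)))"
    by (intro LIMSEQ_le_const) auto
  also have "\<dots> = ((2 * sqrt pi) ^ DIM('a) * sqrt pi ^ DIM('a)) * (\<Sum>i\<in>S. \<Sum>j\<in>S. c i * c j * f (x i - x j))"
    by (simp add: sum_distrib_left mult_ac)
  finally have "0 < ((2 * sqrt pi) ^ DIM('a) * sqrt pi ^ DIM('a)) * (\<Sum>i\<in>S. \<Sum>j\<in>S. c i * c j * f (x i - x j))"
    using \<open>Q 1 > 0\<close> by linarith
  moreover have "((2 * sqrt pi) ^ DIM('a) * sqrt pi ^ DIM('a)) > 0" by simp
  ultimately show ?thesis by (meson zero_less_mult_pos)
qed

section \<open>The Fourier transform of the Buhmann function\<close>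

text \<open>The Buhmann function as a function of \<open>s = \<parallel>x\<parallel>\<^sup>2\<close>.\<close>

definition buhmann_profile :: "real \<Rightarrow> real \<Rightarrow> real \<Rightarrow> real \<Rightarrow> ennreal" where
  "buhmann_profile lam \<alpha> \<rho> s =
     (\<integral>\<^sup>+t\<in>{0<..}. ennreal (pos_powr (1 - s / t) lam * t powr \<alpha> * pos_powr (1 - t) \<rho>) \<partial>lborel)"

lemma buhmann_eq_profile: "buhmann lam \<alpha> \<rho> x = buhmann_profile lam \<alpha> \<rho> ((norm x)\<^sup>2)"
  by (simp add: buhmann_def buhmann_profile_def)

lemma pos_powr_nonneg [simp]: "pos_powr s p \<ge> 0"
  by (simp add: pos_powr_def)

lemma measurable_pos_powr [measurable]:
  assumes [measurable]: "f \<in> borel_measurable M"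
  shows "(\<lambda>x. pos_powr (f x) p) \<in> borel_measurable M"
  unfolding pos_powr_def by measurable

lemma measurable_buhmann_profile [measurable]: "buhmann_profile lam \<alpha> \<rho> \<in> borel_measurable borel"
  unfolding buhmann_profile_def[abs_def] by measurable

text \<open>Substituting \<open>t = s + v\<close> moves the singularity of the integrand for \<open>\<lambda> < 0\<close> to the fixed
  point \<open>v = 0\<close>. As \<open>1 - s / t = v / (s + v)\<close>, the dependence on \<open>s\<close> is through
  \<open>(s + v) powr (\<alpha> - \<lambda>)\<close> and the cut-off factor, which both decrease in \<open>s\<close> when
  \<open>\<alpha> \<le> \<lambda>\<close> and \<open>\<rho> \<ge> 0\<close>.\<close>

lemma buhmann_profile_shift:
  assumes "s \<ge> 0"
  shows "buhmann_profile lam \<alpha> \<rho> s =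
     (\<integral>\<^sup>+v. ennreal (indicator {0<..} v * (v powr lam * (s + v) powr (\<alpha> - lam) * pos_powr (1 - s - v) \<rho>)) \<partial>lborel)"
proof -
  have "buhmann_profile lam \<alpha> \<rho> s = ennreal \<bar>1\<bar> * (\<integral>\<^sup>+v.
     ennreal (pos_powr (1 - s / (s + 1 * v)) lam * (s + 1 * v) powr \<alpha> * pos_powr (1 - (s + 1 * v)) \<rho>) * indicator {0<..} (s + 1 * v) \<partial>lborel)"
    unfolding buhmann_profile_def by (rule nn_integral_real_affine) auto
  also have "\<dots> = (\<integral>\<^sup>+v. ennreal (indicator {0<..} v * (v powr lam * (s + v) powr (\<alpha> - lam) * pos_powr (1 - s - v) \<rho>)) \<partial>lborel)"
    unfolding abs_one ennreal_1 mult_1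
  proof (rule nn_integral_cong)
    fix v :: real
    show "ennreal (pos_powr (1 - s / (s + v)) lam * (s + v) powr \<alpha> * pos_powr (1 - (s + v)) \<rho>) * indicator {0<..} (s + v) =
      ennreal (indicator {0<..} v * (v powr lam * (s + v) powr (\<alpha> - lam) * pos_powr (1 - s - v) \<rho>))"
    proof (cases "s + v > 0")
      case True
      have e: "1 - s / (s + v) = v / (s + v)" using True by (simp add: field_simps)
      show ?thesis
      proof (cases "v > 0")
        case v: True
        have "pos_powr (1 - s / (s + v)) lam * (s + v) powr \<alpha> = v powr lam * (s + v) powr (\<alpha> - lam)"
          using v True by (simp add: e pos_powr_def powr_divide powr_diff)
        then show ?thesis using v True by (simp add: diff_diff_eq)
      next
        case False
        then have "pos_powr (1 - s / (s + v)) lam = 0"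
          using True by (simp add: e pos_powr_def zero_less_divide_iff)
        then show ?thesis using False by simp
      qed
    next
      case False
      then show ?thesis using assms by simp
    qed
  qed
  finally show ?thesis .
qed

lemma buhmann_profile_finite:
  assumes "s > 0" "lam > -1" "\<alpha> \<le> lam" "\<rho> \<ge> 0"
  shows "buhmann_profile lam \<alpha> \<rho> s < top"
proof -
  have "buhmann_profile lam \<alpha> \<rho> s \<le>
      (\<integral>\<^sup>+v. ennreal (s powr (\<alpha> - lam)) * ennreal (indicator {0<..1} v * v powr ((lam + 1) - 1)) \<partial>lborel)"
    unfolding buhmann_profile_shift[OF less_imp_le[OF assms(1)]]
  proof (rule nn_integral_mono)
    fix v :: real
    have "indicator {0<..} v * (v powr lam * (s + v) powr (\<alpha> - lam) * pos_powr (1 - s - v) \<rho>) \<le>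
        s powr (\<alpha> - lam) * (indicator {0<..1} v * v powr lam)"
    proof (cases "0 < v \<and> v < 1 - s")
      case True
      have "(s + v) powr (\<alpha> - lam) \<le> s powr (\<alpha> - lam)"
        using assms True by (intro powr_mono2') auto
      moreover have "pos_powr (1 - s - v) \<rho> \<le> 1"
        using assms True by (auto simp: pos_powr_def intro: powr_le1)
      ultimately have "v powr lam * ((s + v) powr (\<alpha> - lam) * pos_powr (1 - s - v) \<rho>) \<le>
          v powr lam * (s powr (\<alpha> - lam) * 1)"
        by (intro mult_left_mono mult_mono) auto
      then show ?thesis using True assms by (simp add: mult_ac)
    next
      case False
      then show ?thesis by (auto simp: pos_powr_def indicator_def)
    qed
    then show "ennreal (indicator {0<..} v * (v powr lam * (s + v) powr (\<alpha> - lam) * pos_powr (1 - s - v) \<rho>)) \<le>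
        ennreal (s powr (\<alpha> - lam)) * ennreal (indicator {0<..1} v * v powr ((lam + 1) - 1))"
      by (subst ennreal_mult'[symmetric]) (auto intro!: ennreal_leI)
  qed
  also have "\<dots> = ennreal (s powr (\<alpha> - lam)) *
      (\<integral>\<^sup>+v. ennreal (indicator {0<..1} v * v powr ((lam + 1) - 1)) \<partial>lborel)"
    by (rule nn_integral_cmult) auto
  also have "\<dots> < top"
    using assms by (subst nn_integral_powr_Ioc) (auto simp: ennreal_mult_less_top)
  finally show ?thesis .
qed

lemma nn_integral_Beta:
  assumes "a > 0" "b > (0 :: real)"
  shows "(\<integral>\<^sup>+t. ennreal (indicator {0<..<1} t * (t powr (a - 1) * (1 - t) powr (b - 1))) \<partial>lborel) = ennreal (Beta a b)"
  using has_bochner_integral_Beta[OF assms]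
  by (subst nn_integral_eq_integral) (auto simp: has_bochner_integral_iff)

lemma Beta_nonneg: "a > 0 \<Longrightarrow> b > 0 \<Longrightarrow> Beta a b \<ge> (0 :: real)"
  by (auto simp: Beta_def intro!: divide_nonneg_nonneg mult_nonneg_nonneg less_imp_le[OF Gamma_real_pos])

lemma mellin_pos_powr:
  assumes "t > 0" "D > 0" "lam > -1"
  shows "(\<integral>\<^sup>+s. ennreal (indicator {0<..} s * (pos_powr (1 - s / t) lam * s powr (D - 1))) \<partial>lborel) =
     ennreal (t powr D * Beta D (lam + 1))"
proof -
  have "(\<integral>\<^sup>+s. ennreal (indicator {0<..} s * (pos_powr (1 - s / t) lam * s powr (D - 1))) \<partial>lborel) =
      ennreal \<bar>t\<bar> * (\<integral>\<^sup>+u. ennreal (indicator {0<..} (0 + t * u) * (pos_powr (1 - (0 + t * u) / t) lam * (0 + t * u) powr (D - 1))) \<partial>lborel)"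
    by (rule nn_integral_real_affine) (use assms in auto)
  also have "\<dots> = ennreal t * (\<integral>\<^sup>+u. ennreal (t powr (D - 1)) * ennreal (indicator {0<..<1} u * (u powr (D - 1) * (1 - u) powr ((lam + 1) - 1))) \<partial>lborel)"
  proof -
    have "indicator {0<..} (0 + t * u) * (pos_powr (1 - (0 + t * u) / t) lam * (0 + t * u) powr (D - 1)) =
        t powr (D - 1) * (indicator {0<..<1} u * (u powr (D - 1) * (1 - u) powr ((lam + 1) - 1)))" for u
      using assms by (auto simp: indicator_def pos_powr_def powr_mult zero_less_mult_iff)
    then show ?thesis using assms by (simp add: ennreal_mult')
  qed
  also have "\<dots> = ennreal t * (ennreal (t powr (D - 1)) * ennreal (Beta D (lam + 1)))"
    using nn_integral_Beta[of D "lam + 1"] assms by (subst nn_integral_cmult) auto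
  also have "\<dots> = ennreal (t * t powr (D - 1) * Beta D (lam + 1))"
    using assms by (simp add: ennreal_mult' mult.assoc)
  also have "t * t powr (D - 1) = t powr D"
    using assms by (simp add: powr_diff)
  finally show ?thesis .
qed

text \<open>By Tonelli's theorem, the Mellin transform of a mixture of dilates is a product of two
  Beta integrals.\<close>

lemma mellin_buhmann_profile:
  assumes "D > 0" "lam > -1" "D + \<alpha> + 1 > 0" "\<rho> > -1"
  shows "(\<integral>\<^sup>+s. buhmann_profile lam \<alpha> \<rho> s * ennreal (indicator {0<..} s * s powr (D - 1)) \<partial>lborel) =
     ennreal (Beta D (lam + 1) * Beta (D + \<alpha> + 1) (\<rho> + 1))"
proof -
  let ?f = "\<lambda>s t. ennreal (pos_powr (1 - s / t) lam * t powr \<alpha> * pos_powr (1 - t) \<rho>) * indicator {0<..} t *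
      ennreal (indicator {0<..} s * s powr (D - 1))"
  have "(\<integral>\<^sup>+s. buhmann_profile lam \<alpha> \<rho> s * ennreal (indicator {0<..} s * s powr (D - 1)) \<partial>lborel) =
      (\<integral>\<^sup>+s. \<integral>\<^sup>+t. ?f s t \<partial>lborel \<partial>lborel)"
    unfolding buhmann_profile_def by (subst nn_integral_multc) auto
  also have "\<dots> = (\<integral>\<^sup>+t. \<integral>\<^sup>+s. ?f s t \<partial>lborel \<partial>lborel)"
    by (rule lborel_pair.Fubini') measurable
  also have "\<dots> = (\<integral>\<^sup>+t. ennreal (Beta D (lam + 1)) *
      ennreal (indicator {0<..<1} t * (t powr ((D + \<alpha> + 1) - 1) * (1 - t) powr ((\<rho> + 1) - 1))) \<partial>lborel)"
  proof (rule nn_integral_cong)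
    fix t :: real
    show "(\<integral>\<^sup>+s. ?f s t \<partial>lborel) = ennreal (Beta D (lam + 1)) *
      ennreal (indicator {0<..<1} t * (t powr ((D + \<alpha> + 1) - 1) * (1 - t) powr ((\<rho> + 1) - 1)))"
    proof (cases "t > 0")
      case True
      have "?f s t = ennreal (t powr \<alpha> * pos_powr (1 - t) \<rho>) *
          ennreal (indicator {0<..} s * (pos_powr (1 - s / t) lam * s powr (D - 1)))" for s
        using True by (simp add: ennreal_mult'[symmetric] mult_ac)
      then have "(\<integral>\<^sup>+s. ?f s t \<partial>lborel) = ennreal (t powr \<alpha> * pos_powr (1 - t) \<rho>) * ennreal (t powr D * Beta D (lam + 1))"
        using mellin_pos_powr[OF True assms(1,2)] by (simp only: ) (subst nn_integral_cmult, auto)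
      also have "\<dots> = ennreal (Beta D (lam + 1)) * ennreal (indicator {0<..<1} t * (t powr ((D + \<alpha> + 1) - 1) * (1 - t) powr ((\<rho> + 1) - 1)))"
        using True Beta_nonneg[of D "lam + 1"] assms
        by (subst (1 2) ennreal_mult'[symmetric]) (auto simp: pos_powr_def indicator_def powr_add mult_ac)
      finally show ?thesis .
    qed simp
  qed
  also have "\<dots> = ennreal (Beta D (lam + 1)) * ennreal (Beta (D + \<alpha> + 1) (\<rho> + 1))"
    using nn_integral_Beta[of "D + \<alpha> + 1" "\<rho> + 1"] assms by (subst nn_integral_cmult) auto
  also have "\<dots> = ennreal (Beta D (lam + 1) * Beta (D + \<alpha> + 1) (\<rho> + 1))"
    using Beta_nonneg[of D "lam + 1"] assms by (simp add: ennreal_mult')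
  finally show ?thesis .
qed

text \<open>The Gamma function in the denominator of \<open>cos_transform_radial\<close> cancels the numerator of
  the first Beta integral, which leaves the coefficients of the 1F2.\<close>

lemma cos_transform_buhmann:
  fixes \<xi> :: "'a::euclidean_space" and lam \<alpha> \<rho> :: real
  defines "n \<equiv> real DIM('a)"
  defines "a \<equiv> n / 2 + \<alpha> + 1"
  assumes lam: "lam > -1" "\<alpha> \<le> lam" and a: "a > 0" and \<rho>: "\<rho> \<ge> 0"
  shows "integrable lborel (\<lambda>x::'a. enn2real (buhmann lam \<alpha> \<rho> x))"
    and "(LINT x|lborel. enn2real (buhmann lam \<alpha> \<rho> x) * cos (\<xi> \<bullet> x)) =
      sqrt pi ^ DIM('a) * (Gamma (lam + 1) * Gamma a * Gamma (\<rho> + 1) / (Gamma (n / 2 + lam + 1) * Gamma (a + \<rho> + 1))) *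
      hyp12 a (n / 2 + lam + 1) (a + \<rho> + 1) (- ((norm \<xi>)\<^sup>2 / 4))"
proof -
  define b c where "b = n / 2 + lam + 1" and "c = a + \<rho> + 1"
  have n: "n / 2 \<ge> 1/2" unfolding n_def by (simp add: Suc_leI)
  have pos: "a > 0" "b > 0" "c > 0" "\<rho> + 1 > 0" "lam + 1 > 0" using a lam \<rho> n by (auto simp: b_def c_def)
  define C where "C = Gamma (lam + 1) * Gamma a * Gamma (\<rho> + 1) / (Gamma b * Gamma c)"
  define g where "g s = enn2real (buhmann_profile lam \<alpha> \<rho> s)" for s
  have g: "g \<in> borel_measurable borel" unfolding g_def by measurable
  define m where "m k = Beta (n / 2 + real k) (lam + 1) * Beta (a + real k) (\<rho> + 1)" for k
  have m_nonneg: "m k \<ge> 0" for k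
    unfolding m_def using n pos by (intro mult_nonneg_nonneg Beta_nonneg) auto
  have mellin: "(\<integral>\<^sup>+s. ennreal (g s) * ennreal (indicator {0<..} s * s powr (n / 2 + real k - 1)) \<partial>lborel) = ennreal (m k)" for k
  proof -
    have "(\<integral>\<^sup>+s. ennreal (g s) * ennreal (indicator {0<..} s * s powr (n / 2 + real k - 1)) \<partial>lborel) =
       (\<integral>\<^sup>+s. buhmann_profile lam \<alpha> \<rho> s * ennreal (indicator {0<..} s * s powr (n / 2 + real k - 1)) \<partial>lborel)"
    proof (rule nn_integral_cong)
      fix s :: real
      \<comment> \<open>Only \<open>s > 0\<close> counts; at \<open>s = 0\<close> the profile may be infinite, and \<open>g\<close> is then \<open>0\<close>.\<close>
      show "ennreal (g s) * ennreal (indicator {0<..} s * s powr (n / 2 + real k - 1)) =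
          buhmann_profile lam \<alpha> \<rho> s * ennreal (indicator {0<..} s * s powr (n / 2 + real k - 1))"
        using buhmann_profile_finite[of s lam \<alpha> \<rho>] lam \<rho> by (cases "s > 0") (auto simp: g_def)
    qed
    also have "\<dots> = ennreal (m k)"
      using mellin_buhmann_profile[of "n / 2 + real k" lam \<alpha> \<rho>] lam n a \<rho>
      by (simp add: m_def a_def add_ac)
    finally show ?thesis .
  qed
  have coeff: "m k / (Gamma (n / 2 + real k) * fact k) = C * hyp12_coeff a b c k" for k
  proof -
    have G: "Gamma (n / 2 + real k) > 0" using n by (intro Gamma_real_pos) auto
    have "a \<notin> \<int>\<^sub>\<le>\<^sub>0" "b \<notin> \<int>\<^sub>\<le>\<^sub>0" "c \<notin> \<int>\<^sub>\<le>\<^sub>0"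
      using pos by (auto elim!: nonpos_Ints_cases)
    moreover have "Gamma a > 0" "Gamma b > 0" "Gamma c > 0"
      using pos by (auto intro!: Gamma_real_pos)
    moreover have e: "n / 2 + real k + (lam + 1) = b + real k" "a + real k + (\<rho> + 1) = c + real k"
      by (auto simp: b_def c_def)
    ultimately show ?thesis
      using G unfolding m_def Beta_def e by (simp add: C_def hyp12_coeff_def pochhammer_Gamma mult_ac)
  qed
  have sm: "summable (\<lambda>k. m k / (Gamma (n / 2 + real k) * fact k) * ((norm \<xi>)\<^sup>2 / 4) ^ k)"
    unfolding coeff mult.assoc
    by (intro summable_mult summable_norm_cancel[OF summable_hyp12] pos)
  note main = cos_transform_radial[where 'a = 'a and g = g and m = m and \<xi> = \<xi>, folded n_def, OF g _ mellin m_nonneg sm]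
  show "integrable lborel (\<lambda>x::'a. enn2real (buhmann lam \<alpha> \<rho> x))"
    using main(1) by (simp add: g_def buhmann_eq_profile)
  have "(\<lambda>k. sqrt pi ^ DIM('a) * C * (hyp12_coeff a b c k * (- ((norm \<xi>)\<^sup>2 / 4)) ^ k)) sums
     (LINT x|lborel. g ((norm x)\<^sup>2) * cos (\<xi> \<bullet> x))"
    using main(2) unfolding coeff by (simp add: g_def mult.assoc)
  moreover have "(\<lambda>k. sqrt pi ^ DIM('a) * C * (hyp12_coeff a b c k * (- ((norm \<xi>)\<^sup>2 / 4)) ^ k)) sums
     (sqrt pi ^ DIM('a) * C * hyp12 a b c (- ((norm \<xi>)\<^sup>2 / 4)))"
    by (intro sums_mult hyp12_sums pos)
  ultimately show "(LINT x|lborel. enn2real (buhmann lam \<alpha> \<rho> x) * cos (\<xi> \<bullet> x)) =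
      sqrt pi ^ DIM('a) * (Gamma (lam + 1) * Gamma a * Gamma (\<rho> + 1) / (Gamma (n / 2 + lam + 1) * Gamma (a + \<rho> + 1))) *
      hyp12 a (n / 2 + lam + 1) (a + \<rho> + 1) (- ((norm \<xi>)\<^sup>2 / 4))"
    by (simp add: g_def buhmann_eq_profile sums_iff C_def b_def c_def)
qed

lemma fourier_transform_even:
  fixes f :: "'a::euclidean_space \<Rightarrow> real"
  assumes f: "integrable lborel f" and even: "\<And>x. f (- x) = f x"
  shows "fourier_transform f \<xi> = of_real (LINT x|lborel. f x * cos (\<xi> \<bullet> x))"
proof -
  have [measurable]: "f \<in> borel_measurable borel" using f by auto
  have c: "integrable lborel (\<lambda>x. f x * cos (\<xi> \<bullet> x))"
    by (rule Bochner_Integration.integrable_bound[OF f]) (auto simp: abs_mult mult_left_le)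
  have s: "integrable lborel (\<lambda>x. f x * sin (\<xi> \<bullet> x))"
    by (rule Bochner_Integration.integrable_bound[OF f]) (auto simp: abs_mult mult_left_le)
  have s0: "(LINT x|lborel. f x * sin (\<xi> \<bullet> x)) = 0"
    by (rule integral_even_sin_eq_0) (simp_all add: even)
  have "of_real (f x) * exp (- \<i> * of_real (\<xi> \<bullet> x)) =
      of_real (f x * cos (\<xi> \<bullet> x)) - \<i> * of_real (f x * sin (\<xi> \<bullet> x))" for x
    by (simp add: complex_eq_iff Re_exp Im_exp)
  then have "fourier_transform f \<xi> =
      (LINT x|lborel. of_real (f x * cos (\<xi> \<bullet> x)) - \<i> * of_real (f x * sin (\<xi> \<bullet> x)))"
    unfolding fourier_transform_def by (simp only:)
  also have "\<dots> = of_real (LINT x|lborel. f x * cos (\<xi> \<bullet> x)) - \<i> * of_real (LINT x|lborel. f x * sin (\<xi> \<bullet> x))"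
    using c s by (subst Bochner_Integration.integral_diff) (auto simp del: of_real_mult)
  finally show ?thesis by (simp add: s0)
qed

section \<open>Positive definiteness of the Buhmann function\<close>

text \<open>The truncated power may jump at \<open>0\<close>, as it does for \<open>p = 0\<close>.\<close>

lemma tendsto_pos_powr:
  assumes "(f \<longlongrightarrow> y) F" "y \<noteq> 0"
  shows "((\<lambda>n. pos_powr (f n) p) \<longlongrightarrow> pos_powr y p) F"
proof (cases "y > 0")
  case True
  have "((\<lambda>n. f n powr p) \<longlongrightarrow> y powr p) F"
    using assms by (intro tendsto_powr) auto
  moreover have "\<forall>\<^sub>F n in F. f n powr p = pos_powr (f n) p"
    using order_tendstoD(1)[OF assms(1) True] by eventually_elim (simp add: pos_powr_def)
  ultimately show ?thesis
    using True by (simp add: pos_powr_def Lim_transform_eventually)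
next
  case False
  then have "y < 0" using assms(2) by simp
  have "\<forall>\<^sub>F n in F. pos_powr (f n) p = 0"
    using order_tendstoD(2)[OF assms(1) \<open>y < 0\<close>] by eventually_elim (simp add: pos_powr_def)
  then show ?thesis using \<open>y < 0\<close> by (simp add: pos_powr_def tendsto_eventually)
qed

lemma pos_powr_mono: "s \<le> t \<Longrightarrow> p \<ge> 0 \<Longrightarrow> pos_powr s p \<le> pos_powr t p"
  by (auto simp: pos_powr_def intro: powr_mono2)

text \<open>In the shifted form the integrand is largest at \<open>s = 0\<close>. If its integral there is finite,
  it dominates all the others, and continuity is dominated convergence.\<close>

lemma buhmann_profile_bounded_continuous:
  assumes "lam > -1" "\<alpha> \<le> lam" "\<rho> \<ge> 0" and fin: "buhmann_profile lam \<alpha> \<rho> 0 < top"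
  shows "continuous_on {0..} (\<lambda>s. enn2real (buhmann_profile lam \<alpha> \<rho> s))"
    and "\<And>s. s \<ge> 0 \<Longrightarrow> buhmann_profile lam \<alpha> \<rho> s \<le> buhmann_profile lam \<alpha> \<rho> 0"
proof -
  define \<phi> where "\<phi> s v = indicator {0<..} v * (v powr lam * (s + v) powr (\<alpha> - lam) * pos_powr (1 - s - v) \<rho>)" for s v
  have nonneg: "\<phi> s v \<ge> 0" for s v by (auto simp: \<phi>_def)
  have [measurable]: "\<phi> s \<in> borel_measurable borel" for s unfolding \<phi>_def[abs_def] by measurable
  have profile: "buhmann_profile lam \<alpha> \<rho> s = (\<integral>\<^sup>+v. ennreal (\<phi> s v) \<partial>lborel)" if "s \<ge> 0" for s
    unfolding \<phi>_def by (rule buhmann_profile_shift[OF that])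
  have dom: "\<phi> s v \<le> \<phi> 0 v" if "s \<ge> 0" for s v
  proof (cases "v > 0")
    case True
    have "(s + v) powr (\<alpha> - lam) * pos_powr (1 - s - v) \<rho> \<le> v powr (\<alpha> - lam) * pos_powr (1 - v) \<rho>"
      using assms True that by (intro mult_mono powr_mono2' pos_powr_mono) auto
    then have "v powr lam * ((s + v) powr (\<alpha> - lam) * pos_powr (1 - s - v) \<rho>) \<le>
        v powr lam * (v powr (\<alpha> - lam) * pos_powr (1 - v) \<rho>)"
      by (intro mult_left_mono) auto
    then show ?thesis using True by (simp add: \<phi>_def mult.assoc)
  qed (simp add: \<phi>_def)
  show "buhmann_profile lam \<alpha> \<rho> s \<le> buhmann_profile lam \<alpha> \<rho> 0" if "s \<ge> 0" for s
    unfolding profile[OF that] profile[OF order_refl] by (intro nn_integral_mono ennreal_leI dom that)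
  have int0: "integrable lborel (\<phi> 0)"
    by (rule integrableI_nonneg) (use fin profile[of 0] nonneg in auto)
  have eq: "enn2real (buhmann_profile lam \<alpha> \<rho> s) = (LINT v|lborel. \<phi> s v)" if "s \<ge> 0" for s
    unfolding profile[OF that] by (rule integral_eq_nn_integral[symmetric]) (auto simp: nonneg)
  show "continuous_on {0..} (\<lambda>s. enn2real (buhmann_profile lam \<alpha> \<rho> s))"
  proof (rule continuous_on_sequentiallyI)
    fix u :: "nat \<Rightarrow> real" and s assume u: "\<forall>n. u n \<in> {0..}" "s \<in> {0..}" "u \<longlonglongrightarrow> s"
    have "(\<lambda>n. LINT v|lborel. \<phi> (u n) v) \<longlonglongrightarrow> (LINT v|lborel. \<phi> s v)"
    proof (rule integral_dominated_convergence[where w = "\<phi> 0"])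
      show "AE v in lborel. norm (\<phi> (u n) v) \<le> \<phi> 0 v" for n
        using dom[of "u n"] nonneg u(1) by auto
      \<comment> \<open>The point at which the cut-off factor may jump.\<close>
      have "AE v in lborel. v \<noteq> 1 - s" by (rule AE_lborel_singleton)
      then show "AE v in lborel. (\<lambda>n. \<phi> (u n) v) \<longlonglongrightarrow> \<phi> s v"
      proof eventually_elim
        case (elim v)
        show ?case
        proof (cases "v > 0")
          case True
          have "(\<lambda>n. pos_powr (1 - u n - v) \<rho>) \<longlonglongrightarrow> pos_powr (1 - s - v) \<rho>"
            using elim by (intro tendsto_pos_powr tendsto_intros u(3)) auto
          then show ?thesis
            unfolding \<phi>_def using True u(2) by (intro tendsto_intros u(3)) auto
        qed (simp add: \<phi>_def)
      qed
    qed (auto simp: int0)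
    then show "(\<lambda>n. enn2real (buhmann_profile lam \<alpha> \<rho> (u n))) \<longlonglongrightarrow> enn2real (buhmann_profile lam \<alpha> \<rho> s)"
      using u by (simp add: eq)
  qed
qed

text \<open>The bounds that define the region, read in terms of the parameters of the 1F2:
  \<open>\<alpha> \<le> \<lambda> - 1/2\<close> is \<open>b \<ge> a + 1/2\<close>, and \<open>2 * \<alpha> \<le> \<lambda> - (n + 1) / 2 + \<rho>\<close> is
  \<open>b + c \<ge> 3 * a + 1/2\<close>. The first set in dimension one is where \<open>b \<ge> 2 * a\<close>.\<close>

lemma buhmann_region_parameters:
  assumes "(lam, \<alpha>) \<in> buhmann_region n \<rho>" "\<rho> \<ge> 0" "n \<ge> 1"
  defines "a \<equiv> real n / 2 + \<alpha> + 1" and "b \<equiv> real n / 2 + lam + 1"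
  shows "lam > -1" "\<alpha> \<le> lam" "a > 0"
    "b \<ge> 2 * a \<or> (b \<ge> a + 1/2 \<and> b + (a + \<rho> + 1) \<ge> 3 * a + 1/2)"
  using assms by (auto simp: buhmann_region_def field_simps split: if_splits)

theorem theorem5p4:
  fixes \<rho> lam \<alpha> :: real and W :: "real ^ 'n \<Rightarrow> ennreal"
  assumes "\<rho> \<ge> 0"
    and "(lam, \<alpha>) \<in> buhmann_region CARD('n) \<rho>"
    and "W = buhmann lam \<alpha> \<rho>"
  shows "integrable lborel (\<lambda>x. enn2real (W x)) \<and>
    (\<forall>\<xi>. fourier_transform (\<lambda>x. enn2real (W x)) \<xi> \<in> \<real>\<^sub>\<ge>\<^sub>0) \<and>
    (\<exists>\<xi>. fourier_transform (\<lambda>x. enn2real (W x)) \<xi> \<noteq> 0) \<and>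
    induces_positive_definite (\<lambda>x. enn2ereal (W x))"
proof -
  define n where "n = real CARD('n)"
  define a b c where "a = n / 2 + \<alpha> + 1" and "b = n / 2 + lam + 1" and "c = a + \<rho> + 1"
  have "CARD('n) \<ge> 1" by (simp add: Suc_leI)
  note par = buhmann_region_parameters[OF assms(2,1) this, folded n_def, folded a_def b_def, folded c_def]
  have pos: "a > 0" "b > 0" "c > 0" "lam + 1 > 0" "\<rho> + 1 > 0"
    using par(1,3) assms(1) by (auto simp: b_def c_def n_def add_nonneg_pos)
  define f where "f x = enn2real (W x)" for x
  define F where "F \<xi> = (LINT x|lborel. f x * cos (\<xi> \<bullet> x))" for \<xi>
  define K where "K = sqrt pi ^ CARD('n) * (Gamma (lam + 1) * Gamma a * Gamma (\<rho> + 1) / (Gamma b * Gamma c))"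
  have K: "K > 0"
    unfolding K_def using pos by (intro mult_pos_pos divide_pos_pos Gamma_real_pos zero_less_power) auto
  have W: "W x = buhmann_profile lam \<alpha> \<rho> ((norm x)\<^sup>2)" for x
    unfolding assms(3) by (rule buhmann_eq_profile)
  have even: "f (- x) = f x" for x by (simp add: f_def W)
  have int: "integrable lborel f"
    using cos_transform_buhmann(1)[where 'a = "real ^ 'n", of lam \<alpha> \<rho>] par(1-3) assms(1)
    by (simp add: f_def[abs_def] assms(3) a_def n_def)
  have F: "F \<xi> = K * hyp12 a b c (- ((norm \<xi>)\<^sup>2 / 4))" for \<xi>
    using cos_transform_buhmann(2)[of lam \<alpha> \<rho> \<xi>] par(1-3) assms(1)
    by (simp add: F_def f_def assms(3) K_def a_def b_def c_def n_def)
  have F_nonneg: "F \<xi> \<ge> 0" for \<xi>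
    unfolding F using K par(3,4) assms(1)
    by (intro mult_nonneg_nonneg hyp12_nonneg) (auto simp: c_def)
  have "hyp12 a b c 0 = 1" by (simp only: hyp12_def powser_zero) (simp add: hyp12_coeff_def)
  then have F_0: "F 0 > 0" unfolding F using K by simp
  have FT: "fourier_transform f \<xi> = of_real (F \<xi>)" for \<xi>
    unfolding F_def by (rule fourier_transform_even[OF int even])
  have "induces_positive_definite (\<lambda>x. enn2ereal (W x))"
    unfolding induces_positive_definite_def positive_definite_def
  proof (intro allI impI conjI ballI)
    fix N and x :: "nat \<Rightarrow> real ^ 'n" assume inj: "inj_on x {..<N}"
    let ?I = "{..<N}"
    show "enn2ereal (W (x i - x j)) = enn2ereal (W (x j - x i))" for i j
      by (simp add: W norm_minus_commute)
    show "enn2ereal (W (x i - x i)) \<noteq> - \<infinity>" for i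
      using enn2ereal_nonneg[of "W (x i - x i)"] by auto
    have fin: "W z < top" if "z \<noteq> 0" for z
      unfolding W using buhmann_profile_finite[of "(norm z)\<^sup>2" lam \<alpha> \<rho>] that par(1,2) assms(1) by simp
    have real: "enn2ereal (W z) = ereal (f z)" if "W z < top" for z
      using that unfolding f_def by (cases "W z") auto
    show off: "\<bar>enn2ereal (W (x i - x j))\<bar> \<noteq> \<infinity>" if "i \<in> ?I" "j \<in> ?I" "i \<noteq> j" for i j
    proof -
      have "x i - x j \<noteq> 0" using inj that by (auto simp: inj_on_def)
      then show ?thesis using real[OF fin] by simp
    qed
    fix c :: "nat \<Rightarrow> real" assume c: "\<exists>i\<in>?I. c i \<noteq> 0"
    show "0 < (\<Sum>i\<in>?I. \<Sum>j\<in>?I. ereal (c i * c j) * enn2ereal (W (x i - x j)))"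
    proof (cases "W 0 < top")
      case True
      have all_fin: "W z < top" for z using True fin by (cases "z = 0") auto
      have p0: "buhmann_profile lam \<alpha> \<rho> 0 < top" using True by (simp add: W)
      note prof = buhmann_profile_bounded_continuous[OF par(1,2) assms(1) p0]
      have "continuous_on UNIV f"
        unfolding f_def W by (rule continuous_on_compose2[OF prof(1)]) (auto intro!: continuous_intros)
      moreover have "\<bar>f z\<bar> \<le> enn2real (W 0)" for z
        using prof(2)[of "(norm z)\<^sup>2"] p0 by (simp add: f_def W enn2real_mono)
      ultimately have "0 < (\<Sum>i\<in>?I. \<Sum>j\<in>?I. c i * c j * f (x i - x j))"
        using positive_definite_of_cos_transform[OF int _ _ even _ _ _ inj c] F_nonneg F_0
        unfolding F_def by blast
      then show ?thesis by (simp add: real[OF all_fin])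
    next
      case False
      then have "enn2ereal (W 0) = \<infinity>" by (simp add: less_top[symmetric])
      \<comment> \<open>Entries off the diagonal are finite and those on it have nonnegative coefficients, so one
        infinite term makes the whole sum infinite.\<close>
      obtain k where k: "k \<in> ?I" "c k \<noteq> 0" using c by blast
      have "ereal (c k * c k) * enn2ereal (W (x k - x k)) = \<infinity>"
        using k \<open>enn2ereal (W 0) = \<infinity>\<close> by simp
      then have "(\<Sum>j\<in>?I. ereal (c k * c j) * enn2ereal (W (x k - x j))) = \<infinity>"
        using k by (subst sum_Pinfty) blast
      then have "(\<Sum>i\<in>?I. \<Sum>j\<in>?I. ereal (c i * c j) * enn2ereal (W (x i - x j))) = \<infinity>"
        using k by (subst sum_Pinfty) blast
      then show ?thesis by simp
    qed
  qed
  moreover have "fourier_transform f \<xi> \<in> \<real>\<^sub>\<ge>\<^sub>0" for \<xi>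
    unfolding FT using F_nonneg by simp
  moreover have "fourier_transform f 0 \<noteq> 0"
    unfolding FT using F_0 by simp
  ultimately show ?thesis using int unfolding f_def by blast
qed

end
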